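(* Let $b=\pi^2/(12\log 2)$. For any $0<\varepsilon\le b$, we have $$\limsup_{n\to\infty}\frac1n\log\lambda\left\{x\in[0,1):\frac{\log q_n(x)}{n}\le b-\varepsilon\right\}\le\theta_2(\varepsilon),$$ and for any $0<\varepsilon\le b-\log 2$, $$\liminf_{n\to\infty}\frac1n\log\lambda\left\{x\in[0,1):\frac{\log q_n(x)}{n}\le b-\varepsilon\right\}\ge-2\log b^{\ast}_\varepsilon-\log 3,$$ where $\theta_2(\varepsilon)=\inf_{t>0}\big\{t(b-\varepsilon)+\mathrm{P}(1+t/2)\big\}<0$ (the negativity being part of the assertion) and $b^{\ast}_\varepsilon$ denotes the largest integer no greater than $e^{b-\varepsilon}-1$.
   Context: $\lambda$ is Lebesgue measure on $[0,1)$. Every irrational $x\in[0,1)$ has a unique regular continued fraction expansion $x=[a_1(x),a_2(x),\dots]=\cfrac{1}{a_1(x)+\cfrac{1}{a_2(x)+\cdots}}$ with positive integers $a_n(x)$, where $a_1(x)=\lfloor 1/x\rfloor$, $a_{n+1}(x)=a_1(T^n x)$, $T(0)=0$, $T(x)=1/x-\lfloor 1/x\rfloor$ for $x\in(0,1)$. $q_n(x)$ is the denominator of the $n$-th convergent $p_n(x)/q_n(x)=[a_1(x),\dots,a_n(x)]$ in lowest terms; equivalently $q_{-1}=0$, $q_0=1$, $q_n=a_nq_{n-1}+q_{n-2}$. Rational $x$ (finite expansions) form a $\lambda$-null set and may be ignored in the sets measured. For positive integers $a_1,\dots,a_n$, $q_n([a_1,\dots,a_n])$ denotes the denominator given by this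 recursion. The Diophantine pressure function is, for real $\theta>1/2$, $$\mathrm{P}(\theta)=\lim_{n\to\infty}\frac1n\log\sum_{a_1,\dots,a_n\ge1}q_n^{-2\theta}([a_1,\dots,a_n]),$$ the sum being over all $n$-tuples of positive integers (the limit exists and is finite for $\theta>1/2$). Values are taken in the extended reals with $\log 0=-\infty$; the infimum $\theta_2(\varepsilon)$ may be $-\infty$. *)

theory Defs
  imports "HOL-Analysis.Analysis"
begin

definition gauss_map :: "real \<Rightarrow> real" where
  "gauss_map x = (if x = 0 then 0 else 1 / x - of_int \<lfloor>1 / x\<rfloor>)"

text \<open>
  Digits are indexed from 1: for irrational x in [0,1) and n at least 1, the value at n is
  the n-th partial quotient. For rational x the digits become 0 once the expansion
  has ended; the value at index 0 is never used.
\<close>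

definition cf_digit :: "real \<Rightarrow> nat \<Rightarrow> nat" where
  "cf_digit x n = nat \<lfloor>1 / (gauss_map ^^ (n - 1)) x\<rfloor>"

text \<open>
  The second equation is the general recursion with the convention that the denominator
  of index -1 is 0. Only the entries of \<open>a\<close> at the indices 1 to n matter.
\<close>

fun cf_denom :: "(nat \<Rightarrow> nat) \<Rightarrow> nat \<Rightarrow> nat" where
  "cf_denom a 0 = 1"
| "cf_denom a (Suc 0) = a 1"
| "cf_denom a (Suc (Suc n)) = a (Suc (Suc n)) * cf_denom a (Suc n) + cf_denom a n"

definition cf_q :: "nat \<Rightarrow> real \<Rightarrow> nat" where
  "cf_q n x = cf_denom (cf_digit x) n"

text \<open>
  An n-tuple of positive integers is an extensional function on \<open>{1..n}\<close>. The sums are finite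
  and the limit exists for \<open>\<theta> > 1/2\<close>; the value is meaningless for smaller \<open>\<theta>\<close>.
\<close>

definition pressure :: "real \<Rightarrow> real" where
  "pressure \<theta> =
     lim (\<lambda>n. (1 / real n) *
       ln (\<Sum>\<^sub>\<infinity>a\<in>({1..n} \<rightarrow>\<^sub>E {1..}). real (cf_denom a n) powr (- 2 * \<theta>)))"

text \<open>Logarithm of a nonnegative real, with \<open>log 0 = -\<infinity>\<close>.\<close>

definition elog :: "real \<Rightarrow> ereal" where
  "elog x = (if x = 0 then - \<infinity> else ereal (ln x))"

definition levy_const :: real where
  "levy_const = pi\<^sup>2 / (12 * ln 2)"

text \<open>The rationals, a null set for which not all partial quotients exist, are left out.\<close>

definition slow_set :: "real \<Rightarrow> nat \<Rightarrow> real set" where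
  "slow_set \<epsilon> n =
     {x \<in> {0..<1} - \<rat>. ln (real (cf_q n x)) / real n \<le> levy_const - \<epsilon>}"

definition log_rate :: "real \<Rightarrow> nat \<Rightarrow> ereal" where
  "log_rate \<epsilon> n = ereal (1 / real n) * elog (measure lebesgue (slow_set \<epsilon> n))"

definition theta2 :: "real \<Rightarrow> ereal" where
  "theta2 \<epsilon> =
     (INF t\<in>{0<..}. ereal (t * (levy_const - \<epsilon>) + pressure (1 + t / 2)))"

definition bstar :: "real \<Rightarrow> int" where
  "bstar \<epsilon> = \<lfloor>exp (levy_const - \<epsilon>) - 1\<rfloor>"

end

theory Submission
  imports Defs "HOL-Real_Asymp.Real_Asymp"
begin

text \<open>
  Upper bound: the cylinder of a digit tuple has length at most \<open>1 / q_n\<^sup>2\<close>, so on tuples with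
  \<open>q_n \<le> Q = exp (n (b - \<epsilon>))\<close> a Chernoff bound \<open>q_n\<^sup>-\<^sup>2 \<le> Q\<^sup>t q_n\<^sup>-\<^sup>2\<^sup>-\<^sup>t\<close> gives the claim for every \<open>t\<close>.
  Lower bound: the single cylinder with all digits equal to \<open>b\<^sup>*\<close> is long enough.

  For \<open>\<theta>\<^sub>2 < 0\<close> one needs \<open>P (1 + t / 2) \<le> - t m\<close> for any \<open>m < b\<close> and some small \<open>t > 0\<close>. The
  normalised Gauss transfer operator \<open>U\<close> reverses monotonicity, halves the oscillation of monotone
  functions and preserves the integral against \<open>dx / (1 + x)\<close>; hence \<open>U\<^sup>n f\<close> tends uniformly to the
  mean of \<open>f\<close>, where \<open>f\<close> is \<open>- ln\<close> truncated near 0, and this mean is close to \<open>b\<close> by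
  \<open>\<integral> - ln x / (1 + x) dx = \<pi>\<^sup>2 / 12\<close>. Solving the Poisson equation \<open>\<phi> - U \<phi> \<ge> m - U f\<close> by a finite sum
  of iterates makes \<open>1 + t \<phi>\<close> a strict subsolution of the perturbed operator
  \<open>g \<mapsto> U (y\<^sup>t g)\<close>, with factor \<open>1 - t m\<close>.
\<close>

subsection \<open>The Gauss transfer operator\<close>

text \<open>
  The weight of the digit \<open>j + 1\<close> is \<open>(j + 1 + x)\<^sup>-\<^sup>2 h (y) / h (x)\<close>, where \<open>h (x) = 1 / (1 + x)\<close> is the
  Gauss density and \<open>y\<close> the inverse branch; this normalisation makes the weights sum to 1.
\<close>

definition gauss_weight :: "nat \<Rightarrow> real \<Rightarrow> real" where
  "gauss_weight j x = (1 + x) / ((real j + 1 + x) * (real j + 2 + x))"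

definition gauss_branch :: "nat \<Rightarrow> real \<Rightarrow> real" where
  "gauss_branch j x = 1 / (real j + 1 + x)"

definition gauss_op :: "(real \<Rightarrow> real) \<Rightarrow> real \<Rightarrow> real" where
  "gauss_op g x = (\<Sum>j. gauss_weight j x * g (gauss_branch j x))"

lemma gauss_weight_nonneg: "0 \<le> x \<Longrightarrow> 0 \<le> gauss_weight j x"
  by (simp add: gauss_weight_def)

lemma gauss_branch_mem: "0 \<le> x \<Longrightarrow> gauss_branch j x \<in> {0<..1}"
  by (simp add: gauss_branch_def field_simps)

lemma gauss_branch_mem': "0 \<le> x \<Longrightarrow> gauss_branch j x \<in> {0..1}"
  using gauss_branch_mem[of x j] by simp

text \<open>Used twice: it gives total weight 1, and it supplies the differences for the summation
  by parts behind the reversal of monotonicity.\<close>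

lemma gauss_weight_telescope:
  assumes "0 \<le> x"
  shows "gauss_weight j x = (1 + x) / (real j + 1 + x) - (1 + x) / (real (Suc j) + 1 + x)"
proof -
  have "real j + 1 + x > 0" "real j + 2 + x > 0" using assms by auto
  then show ?thesis by (simp add: gauss_weight_def divide_simps) (simp add: algebra_simps)
qed

lemma gauss_weight_tail: "(\<lambda>j. (1 + x) / (real j + 1 + x)) \<longlonglongrightarrow> 0" for x :: real
  by real_asymp

lemma gauss_weight_sums:
  assumes "0 \<le> x"
  shows "(\<lambda>j. gauss_weight j x) sums 1"
proof -
  have "(\<lambda>j. (1 + x) / (real j + 1 + x) - (1 + x) / (real (Suc j) + 1 + x)) sums
      ((1 + x) / (real 0 + 1 + x) - 0)"
    by (rule telescope_sums'[OF gauss_weight_tail])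
  then show ?thesis using assms by (simp add: gauss_weight_telescope)
qed

lemma gauss_op_summable:
  assumes "0 \<le> x" "\<And>y. y \<in> {0..1} \<Longrightarrow> \<bar>g y\<bar> \<le> M"
  shows "summable (\<lambda>j. gauss_weight j x * g (gauss_branch j x))"
proof (rule summable_comparison_test)
  show "\<exists>N. \<forall>j\<ge>N. norm (gauss_weight j x * g (gauss_branch j x)) \<le> gauss_weight j x * M"
    using gauss_weight_nonneg[OF assms(1)] assms(2)[OF gauss_branch_mem'[OF assms(1)]]
    by (auto simp: abs_mult intro!: mult_mono exI[of _ 0])
  show "summable (\<lambda>j. gauss_weight j x * M)"
    using gauss_weight_sums[OF assms(1)] by (intro summable_mult2) (rule sums_summable)
qed

lemma gauss_op_mono:
  assumes "0 \<le> x" "\<And>y. y \<in> {0..1} \<Longrightarrow> \<bar>f y\<bar> \<le> M" "\<And>y. y \<in> {0..1} \<Longrightarrow> \<bar>g y\<bar> \<le> M'"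
    and "\<And>y. y \<in> {0..1} \<Longrightarrow> f y \<le> g y"
  shows "gauss_op f x \<le> gauss_op g x"
  unfolding gauss_op_def
  by (rule suminf_le)
    (use assms gauss_op_summable[OF assms(1,2)] gauss_op_summable[OF assms(1,3)]
      gauss_branch_mem'[OF assms(1)] gauss_weight_nonneg[OF assms(1)]
      in \<open>auto intro!: mult_left_mono\<close>)

lemma gauss_op_const: "0 \<le> x \<Longrightarrow> gauss_op (\<lambda>_. a) x = a"
  unfolding gauss_op_def using sums_mult2[OF gauss_weight_sums, of x a] by (simp add: sums_iff)

lemma gauss_op_add:
  assumes "0 \<le> x" "\<And>y. y \<in> {0..1} \<Longrightarrow> \<bar>f y\<bar> \<le> M" "\<And>y. y \<in> {0..1} \<Longrightarrow> \<bar>g y\<bar> \<le> M'"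
  shows "gauss_op (\<lambda>y. f y + g y) x = gauss_op f x + gauss_op g x"
  unfolding gauss_op_def
  using suminf_add[OF gauss_op_summable[of x f M, OF assms(1,2)] gauss_op_summable[of x g M', OF assms(1,3)]]
  by (simp add: algebra_simps)

lemma gauss_op_cmult:
  assumes "0 \<le> x" "\<And>y. y \<in> {0..1} \<Longrightarrow> \<bar>f y\<bar> \<le> M"
  shows "gauss_op (\<lambda>y. a * f y) x = a * gauss_op f x"
  unfolding gauss_op_def
  using suminf_mult[OF gauss_op_summable[of x f M, OF assms], where c = a] by (simp add: mult.left_commute)

lemma gauss_op_sum:
  assumes "0 \<le> x" "\<And>i y. i \<in> I \<Longrightarrow> y \<in> {0..1} \<Longrightarrow> \<bar>f i y\<bar> \<le> M"
  shows "gauss_op (\<lambda>y. \<Sum>i\<in>I. f i y) x = (\<Sum>i\<in>I. gauss_op (f i) x)"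
proof -
  have "summable (\<lambda>j. gauss_weight j x * f i (gauss_branch j x))" if "i \<in> I" for i
    by (rule gauss_op_summable[of x "f i" M, OF assms(1) assms(2)[OF that]])
  from suminf_sum[of I "\<lambda>i j. gauss_weight j x * f i (gauss_branch j x)", OF this]
  show ?thesis unfolding gauss_op_def by (simp add: sum_distrib_left)
qed

lemma gauss_op_bounds:
  assumes "0 \<le> x" "\<And>y. y \<in> {0..1} \<Longrightarrow> a \<le> g y \<and> g y \<le> b"
  shows "a \<le> gauss_op g x \<and> gauss_op g x \<le> b"
proof -
  have bd: "\<bar>g y\<bar> \<le> max \<bar>a\<bar> \<bar>b\<bar>" if "y \<in> {0..1}" for y
    using assms(2)[OF that] by linarith
  show ?thesis
    using gauss_op_mono[OF assms(1), of "\<lambda>_. a" "\<bar>a\<bar>" g "max \<bar>a\<bar> \<bar>b\<bar>"]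
      gauss_op_mono[OF assms(1), of g "max \<bar>a\<bar> \<bar>b\<bar>" "\<lambda>_. b" "\<bar>b\<bar>"] bd assms
    by (auto simp: gauss_op_const)
qed

text \<open>Weierstrass test with twice the weights at 0 as majorant: on the unit interval the
  factor \<open>1 + x\<close> is at most 2 and the denominators are smallest at 0. Uniformity
  carries continuity through the operator and permits integration term by term.\<close>

lemma gauss_op_uniform_limit:
  assumes "\<And>y. y \<in> {0..1} \<Longrightarrow> \<bar>g y\<bar> \<le> M"
  shows "uniform_limit {0..1} (\<lambda>n x. \<Sum>j<n. gauss_weight j x * g (gauss_branch j x))
    (gauss_op g) sequentially"
proof -
  have "uniform_limit {0..1} (\<lambda>n x. \<Sum>j<n. gauss_weight j x * g (gauss_branch j x))
    (\<lambda>x. \<Sum>j. gauss_weight j x * g (gauss_branch j x)) sequentially"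
  proof (rule Weierstrass_m_test)
    fix j :: nat and x :: real assume x: "x \<in> {0..1}"
    have "gauss_weight j x \<le> 2 / ((real j + 1) * (real j + 2))"
      unfolding gauss_weight_def using x by (intro frac_le mult_mono) auto
    also have "\<dots> = 2 * gauss_weight j 0" by (simp add: gauss_weight_def)
    finally show "norm (gauss_weight j x * g (gauss_branch j x)) \<le> (2 * gauss_weight j 0) * M"
      using x gauss_weight_nonneg[of x j] gauss_weight_nonneg[of 0 j]
        assms[OF gauss_branch_mem'[of x j]]
      by (auto simp: abs_mult intro!: mult_mono)
  next
    show "summable (\<lambda>j. 2 * gauss_weight j 0 * M)"
      using gauss_weight_sums[of 0] by (intro summable_mult2 summable_mult) (auto intro: sums_summable)
  qed
  then show ?thesis by (simp add: gauss_op_def[abs_def])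
qed

lemma continuous_on_gauss_branch: "continuous_on {0..1} (gauss_branch j)"
  unfolding gauss_branch_def by (intro continuous_intros) auto

lemma continuous_on_gauss_weight: "continuous_on {0..1} (gauss_weight j)"
  unfolding gauss_weight_def by (intro continuous_intros) auto

lemma continuous_on_gauss_partial_sum:
  assumes "continuous_on {0..1} g"
  shows "continuous_on {0..1} (\<lambda>x. \<Sum>j<n::nat. gauss_weight j x * g (gauss_branch j x))"
proof -
  have "continuous_on {0..1} (\<lambda>x. g (gauss_branch j x))" for j
    by (rule continuous_on_compose2[OF assms continuous_on_gauss_branch])
      (use gauss_branch_mem' in auto)
  then show ?thesis
    by (intro continuous_intros continuous_on_gauss_weight) auto
qed

lemma continuous_on_unit_bound:
  fixes g :: "real \<Rightarrow> real"
  assumes "continuous_on {0..1} g"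
  obtains M where "\<And>y. y \<in> {0..1} \<Longrightarrow> \<bar>g y\<bar> \<le> M"
proof -
  have "bounded (g ` {0..1})"
    using assms by (intro compact_imp_bounded compact_continuous_image) auto
  then obtain M where "\<forall>y\<in>{0..1}. \<bar>g y\<bar> \<le> M" by (auto simp: bounded_iff)
  then show ?thesis using that by blast
qed

lemma continuous_on_gauss_op:
  assumes "continuous_on {0..1} g"
  shows "continuous_on {0..1} (gauss_op g)"
proof -
  obtain M where "\<And>y. y \<in> {0..1} \<Longrightarrow> \<bar>g y\<bar> \<le> M"
    using continuous_on_unit_bound[OF assms] by auto
  from gauss_op_uniform_limit[of g M, OF this] continuous_on_gauss_partial_sum[OF assms]
  show ?thesis by (intro uniform_limit_theorem[where F = sequentially]) auto
qed

section \<open>Invariance of the Gauss measure under the transfer operator\<close>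

definition gauss_integral :: "(real \<Rightarrow> real) \<Rightarrow> real" where
  "gauss_integral g = integral {0..1} (\<lambda>x. g x / (1 + x))"

text \<open>The substitution \<open>y = 1 / (j + 1 + x)\<close> turns the \<open>j\<close>-th term
  into the integral of \<open>g y / (1 + y)\<close> over the interval from
  \<open>1 / (j + 2)\<close> to \<open>1 / (j + 1)\<close>, and these intervals tile (0,1].\<close>

lemma gauss_op_invariant:
  assumes g: "continuous_on {0..1} g"
  shows "gauss_integral (gauss_op g) = gauss_integral g"
proof -
  define d where "d = (\<lambda>y. g y / (1 + y))"
  define G where "G = (\<lambda>u. integral {0..u} d)"
  define s where "s = (\<lambda>n::nat. \<lambda>x. (\<Sum>j<n. gauss_weight j x * g (gauss_branch j x)) / (1 + x))"
  have d: "continuous_on {0..1} d"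
    unfolding d_def using g by (intro continuous_intros) auto
  have G': "(G has_vector_derivative d y) (at y within {0..1})" if "y \<in> {0..1}" for y
    unfolding G_def by (rule integral_has_vector_derivative[OF d that])
  \<comment> \<open>An antiderivative of the \<open>j\<close>-th term; the sign is there because the
    branches decrease.\<close>
  have branch: "((\<lambda>x. - G (gauss_branch j x)) has_vector_derivative
      gauss_weight j x * g (gauss_branch j x) / (1 + x)) (at x within {0..1})"
    if x: "x \<in> {0..1}" for j x
  proof -
    define y where "y = gauss_branch j x"
    have pos: "real j + 1 + x > 0" "real j + 2 + x > 0" using x by auto
    have b': "(gauss_branch j has_vector_derivative - (y ^ 2)) (at x within {0..1})"
      unfolding has_real_derivative_iff_has_vector_derivative[symmetric] gauss_branch_def y_def
      using pos by (auto intro!: derivative_eq_intros simp: power2_eq_square)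
    have "(G has_vector_derivative d y) (at (gauss_branch j x) within gauss_branch j ` {0..1})"
      unfolding y_def
      by (rule has_vector_derivative_within_subset[OF G']) (use gauss_branch_mem' x in auto)
    from has_vector_derivative_minus[OF vector_diff_chain_within[OF b' this]]
    have "((\<lambda>x. - G (gauss_branch j x)) has_vector_derivative y\<^sup>2 * d y) (at x within {0..1})"
      by (simp add: o_def)
    moreover have "y\<^sup>2 * d y = gauss_weight j x * g (gauss_branch j x) / (1 + x)"
    proof -
      have "1 + y = (real j + 2 + x) * y" using pos by (simp add: y_def gauss_branch_def field_simps)
      then have "y\<^sup>2 * d y = y / (real j + 2 + x) * g y"
        using pos x gauss_branch_mem[of x j] by (simp add: d_def y_def power2_eq_square)
      also have "y / (real j + 2 + x) = gauss_weight j x / (1 + x)"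
        using x by (simp add: y_def gauss_branch_def gauss_weight_def)
      finally show ?thesis by (simp add: y_def)
    qed
    ultimately show ?thesis by simp
  qed
  \<comment> \<open>The partial sums telescope since
    \<open>gauss_branch j 1 = gauss_branch (Suc j) 0\<close>.\<close>
  have s: "(s n has_integral G 1 - G (1 / (real n + 1))) {0..1}" for n
  proof -
    have "(s n has_integral (\<Sum>j<n. - G (gauss_branch j 1)) - (\<Sum>j<n. - G (gauss_branch j 0))) {0..1}"
      by (rule fundamental_theorem_of_calculus)
        (auto simp: s_def sum_divide_distrib intro!: has_vector_derivative_sum branch)
    also have "(\<Sum>j<n. - G (gauss_branch j 1)) - (\<Sum>j<n. - G (gauss_branch j 0)) =
        (\<Sum>j<n. G (1 / (real j + 1)) - G (1 / (real (Suc j) + 1)))"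
      by (simp add: sum_subtractf[symmetric] gauss_branch_def algebra_simps)
    also have "\<dots> = G (1 / (real 0 + 1)) - G (1 / (real n + 1))"
      by (rule sum_lessThan_telescope')
    finally show ?thesis by simp
  qed
  obtain M where M: "\<And>y. y \<in> {0..1} \<Longrightarrow> \<bar>g y\<bar> \<le> M"
    using continuous_on_unit_bound[OF g] by auto
  have ul: "uniform_limit {0..1} s (\<lambda>x. gauss_op g x / (1 + x)) sequentially"
  proof -
    have "uniform_limit {0..1}
        (\<lambda>n x. (\<Sum>j<n. gauss_weight j x * g (gauss_branch j x)) * (1 / (1 + x)))
        (\<lambda>x. gauss_op g x * (1 / (1 + x))) sequentially"
    proof (intro uniform_lim_mult uniform_limit_const gauss_op_uniform_limit[OF M])
      show "bounded (gauss_op g ` {0..1})"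
        by (intro compact_imp_bounded compact_continuous_image continuous_on_gauss_op g) auto
      show "bounded ((\<lambda>x. 1 / (1 + x)) ` {0..1::real})"
        by (intro compact_imp_bounded compact_continuous_image continuous_intros) auto
    qed
    then show ?thesis by (simp add: s_def)
  qed
  have "continuous_on {0..1} (s n)" for n
    unfolding s_def by (intro continuous_intros continuous_on_gauss_partial_sum g) auto
  from uniform_limit_integral[OF ul this]
  obtain I J where IJ: "\<And>n. (s n has_integral I n) {0..1}"
      "((\<lambda>x. gauss_op g x / (1 + x)) has_integral J) {0..1}" "I \<longlonglongrightarrow> J"
    by auto
  have I: "I n = G 1 - G (1 / (real n + 1))" for n
    using IJ(1) s has_integral_unique by blast
  have "continuous_on {0..1} G"
    using G' by (meson continuous_on_eq_continuous_within has_vector_derivative_continuous)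
  moreover have "(\<lambda>n. 1 / (real n + 1)) \<longlonglongrightarrow> 0" by real_asymp
  ultimately have "(\<lambda>n. G (1 / (real n + 1))) \<longlonglongrightarrow> G 0"
    by (rule continuous_on_tendsto_compose) (auto simp: field_simps)
  then have "I \<longlonglongrightarrow> G 1 - G 0" unfolding I[abs_def] by (intro tendsto_intros)
  with IJ(3) have "J = G 1 - G 0" using LIMSEQ_unique by blast
  then show ?thesis
    using IJ(2) by (simp add: gauss_integral_def G_def d_def integral_unique)
qed

section \<open>Monotone functions and the decay of their oscillation\<close>

text \<open>When the argument grows, weight moves to larger digits, hence to branch points nearer 0,
  and every branch point itself decreases; both effects lower the value for increasing
  \<open>f\<close>. They are treated one after the other: \<open>v\<close> freezes the branch points
  at \<open>x'\<close> while the weights change.\<close>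

lemma gauss_op_antimono:
  assumes f: "mono_on {0..1} f"
  shows "antimono_on {0..1} (gauss_op f)"
proof (rule monotone_onI)
  fix x x' :: real assume x: "x \<in> {0..1}" "x' \<in> {0..1}" "x \<le> x'"
  have bd: "\<bar>f y\<bar> \<le> max \<bar>f 0\<bar> \<bar>f 1\<bar>" if "y \<in> {0..1}" for y
    using mono_onD[OF f, of 0 y] mono_onD[OF f, of y 1] that by auto
  define v where "v = (\<lambda>j. f (gauss_branch j x'))"
  \<comment> \<open>\<open>(1 + x) / (j + 1 + x)\<close> is the total weight at \<open>x\<close> of
    the indices from \<open>j\<close> on, so \<open>D j \<le> 0\<close> says that these tails are
    heavier at \<open>x'\<close>.\<close>
  define D where "D = (\<lambda>j. (1 + x) / (real j + 1 + x) - (1 + x') / (real j + 1 + x'))"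
  have v_anti: "v (Suc j) \<le> v j" for j
    unfolding v_def by (rule mono_onD[OF f]) (use x gauss_branch_mem' in \<open>auto simp: gauss_branch_def intro!: frac_le\<close>)
  have D0: "D j \<le> 0" for j
  proof -
    have "real j * x \<le> real j * x'" using x by (intro mult_left_mono) auto
    then show ?thesis using x unfolding D_def by (simp add: divide_simps) (simp add: algebra_simps)
  qed
  \<comment> \<open>Summation by parts; the boundary term at 0 vanishes because
    \<open>D 0 = 0\<close>.\<close>
  have part: "(\<Sum>j<n. (D j - D (Suc j)) * v j) \<ge> - D n * v n" for n
  proof (induction n)
    case 0 then show ?case using x by (simp add: D_def)
  next
    case (Suc n)
    have "- D (Suc n) * v (Suc n) \<le> - D (Suc n) * v n"
      using v_anti D0 by (intro mult_left_mono) auto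
    then show ?case using Suc by (simp add: algebra_simps)
  qed
  have w: "D j - D (Suc j) = gauss_weight j x - gauss_weight j x'" for j
    using x by (simp add: gauss_weight_telescope D_def)
  have sum1: "summable (\<lambda>j. gauss_weight j x * v j)"
  proof -
    have "\<bar>v j\<bar> \<le> max \<bar>f 0\<bar> \<bar>f 1\<bar>" for j unfolding v_def by (rule bd) (use x gauss_branch_mem' in auto)
    then show ?thesis
      by (intro summable_comparison_test[OF _ summable_mult2[OF sums_summable[OF gauss_weight_sums[of x]], of "max \<bar>f 0\<bar> \<bar>f 1\<bar>"]])
        (use x gauss_weight_nonneg[of x] in \<open>auto simp: abs_mult intro!: mult_mono exI[of _ 0]\<close>)
  qed
  have sum2: "summable (\<lambda>j. gauss_weight j x' * v j)"
    unfolding v_def by (rule gauss_op_summable[OF _ bd]) (use x in auto)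
  have "(\<lambda>n. \<Sum>j<n. (D j - D (Suc j)) * v j) \<longlonglongrightarrow>
      (\<Sum>j. gauss_weight j x * v j) - (\<Sum>j. gauss_weight j x' * v j)"
    unfolding w left_diff_distrib using sums_diff[OF summable_sums[OF sum1] summable_sums[OF sum2]]
    by (simp add: sums_def)
  moreover have "(\<lambda>n. - D n * v n) \<longlonglongrightarrow> 0"
  proof (rule Lim_null_comparison)
    show "\<forall>\<^sub>F n in sequentially. norm (- D n * v n) \<le> \<bar>D n\<bar> * max \<bar>f 0\<bar> \<bar>f 1\<bar>"
      using bd[OF gauss_branch_mem'[of x']] x by (intro always_eventually) (auto simp: abs_mult v_def intro!: mult_left_mono)
    have "D \<longlonglongrightarrow> 0 - 0" unfolding D_def by (intro tendsto_diff gauss_weight_tail)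
    then have "(\<lambda>n. \<bar>D n\<bar> * max \<bar>f 0\<bar> \<bar>f 1\<bar>) \<longlonglongrightarrow> \<bar>0 - 0\<bar> * max \<bar>f 0\<bar> \<bar>f 1\<bar>"
      by (intro tendsto_intros)
    then show "(\<lambda>n. \<bar>D n\<bar> * max \<bar>f 0\<bar> \<bar>f 1\<bar>) \<longlonglongrightarrow> 0" by simp
  qed
  ultimately have "0 \<le> (\<Sum>j. gauss_weight j x * v j) - (\<Sum>j. gauss_weight j x' * v j)"
    using part by (intro LIMSEQ_le) auto
  moreover have "(\<Sum>j. gauss_weight j x * v j) \<le> gauss_op f x"
    unfolding gauss_op_def
  proof (rule suminf_le[OF _ sum1 gauss_op_summable[OF _ bd]])
    show "gauss_weight j x * v j \<le> gauss_weight j x * f (gauss_branch j x)" for j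
      unfolding v_def using x gauss_weight_nonneg[of x j] gauss_branch_mem'
      by (intro mult_left_mono mono_onD[OF f]) (auto simp: gauss_branch_def intro!: frac_le)
  qed (use x in auto)
  ultimately show "gauss_op f x' \<le> gauss_op f x" by (simp add: gauss_op_def v_def)
qed

text \<open>
  Halving of the oscillation rests on this identity: apart from the term \<open>f 1\<close> of weight 1/2, the series
  at 0 is half the series at 1.
\<close>

lemma gauss_op_halves:
  assumes bd: "\<And>y. y \<in> {0..1} \<Longrightarrow> \<bar>f y\<bar> \<le> M"
  shows "gauss_op f 0 = (f 1 + gauss_op f 1) / 2"
proof -
  have "gauss_op f 0 = (\<Sum>j. gauss_weight (Suc j) 0 * f (gauss_branch (Suc j) 0)) + f 1 / 2"
    unfolding gauss_op_def
    by (subst suminf_split_head[OF gauss_op_summable[OF _ bd], of 0 "\<lambda>x. x"])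
       (auto simp: gauss_weight_def gauss_branch_def)
  also have "(\<lambda>j. gauss_weight (Suc j) 0 * f (gauss_branch (Suc j) 0)) =
      (\<lambda>j. gauss_weight j 1 * f (gauss_branch j 1) / 2)"
    proof
    fix j
    have "gauss_weight (Suc j) 0 = gauss_weight j 1 / 2"
      by (simp add: gauss_weight_def divide_simps)
    moreover have "gauss_branch (Suc j) 0 = gauss_branch j 1"
      by (simp add: gauss_branch_def algebra_simps)
    ultimately show "gauss_weight (Suc j) 0 * f (gauss_branch (Suc j) 0) =
        gauss_weight j 1 * f (gauss_branch j 1) / 2" by simp
  qed
  also have "(\<Sum>j. gauss_weight j 1 * f (gauss_branch j 1) / 2) = gauss_op f 1 / 2"
    unfolding gauss_op_def by (rule suminf_divide[OF gauss_op_summable[OF _ bd]]) auto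
  finally show ?thesis by simp
qed

lemma gauss_op_mono_on:
  assumes f: "antimono_on {0..1} f"
  shows "mono_on {0..1} (gauss_op f)"
proof (rule monotone_onI)
  fix x y :: real assume xy: "x \<in> {0..1}" "y \<in> {0..1}" "x \<le> y"
  have bd: "\<bar>f y\<bar> \<le> max \<bar>f 0\<bar> \<bar>f 1\<bar>" if "y \<in> {0..1}" for y
    using monotone_onD[OF f, of 0 y] monotone_onD[OF f, of y 1] that by auto
  have "mono_on {0..1} (\<lambda>y. - 1 * f y)" using f by (auto simp: monotone_on_def)
  from monotone_onD[OF gauss_op_antimono[OF this] xy]
  have "gauss_op (\<lambda>y. - 1 * f y) y \<le> gauss_op (\<lambda>y. - 1 * f y) x" by simp
  then show "gauss_op f x \<le> gauss_op f y"
    using gauss_op_cmult[of x f "max \<bar>f 0\<bar> \<bar>f 1\<bar>" "-1", OF _ bd]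
      gauss_op_cmult[of y f "max \<bar>f 0\<bar> \<bar>f 1\<bar>" "-1", OF _ bd] xy by simp
qed

text \<open>By \<open>gauss_op_halves\<close> the difference of the end values is
  \<open>(f 1 - gauss_op f 1) / 2\<close>, and for monotone \<open>f\<close> the average
  \<open>gauss_op f 1\<close> lies between \<open>f 0\<close> and \<open>f 1\<close>.\<close>

lemma gauss_op_oscillation:
  assumes "mono_on {0..1} f \<or> antimono_on {0..1} f"
  shows "\<bar>gauss_op f 0 - gauss_op f 1\<bar> \<le> \<bar>f 0 - f 1\<bar> / 2"
proof -
  have bd: "min (f 0) (f 1) \<le> f y \<and> f y \<le> max (f 0) (f 1)" if "y \<in> {0..1}" for y
    using assms that monotone_onD[of "{0..1}" "(\<le>)" _ f 0 y] monotone_onD[of "{0..1}" "(\<le>)" _ f y 1]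
    by fastforce
  then have "\<bar>f y\<bar> \<le> max \<bar>f 0\<bar> \<bar>f 1\<bar>" if "y \<in> {0..1}" for y
    using that by fastforce
  then have "gauss_op f 0 = (f 1 + gauss_op f 1) / 2" by (rule gauss_op_halves)
  moreover have "min (f 0) (f 1) \<le> gauss_op f 1 \<and> gauss_op f 1 \<le> max (f 0) (f 1)"
    by (rule gauss_op_bounds) (use bd in auto)
  ultimately show ?thesis by (auto simp: min_def max_def abs_if split: if_splits)
qed

lemma gauss_op_iterate_bounds:
  assumes "\<And>y. y \<in> {0..1} \<Longrightarrow> a \<le> f y \<and> f y \<le> b" "x \<in> {0..1}"
  shows "a \<le> (gauss_op ^^ n) f x \<and> (gauss_op ^^ n) f x \<le> b"
  using assms(2)
proof (induction n arbitrary: x)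
  case (Suc n)
  then show ?case using gauss_op_bounds[of x a "(gauss_op ^^ n) f" b] by simp
qed (use assms in auto)

text \<open>The properties go through one joint induction: each application swaps increasing and
  decreasing, and halving and invariance use the monotonicity and continuity of the previous
  iterate.\<close>

lemma gauss_op_iterate:
  assumes "continuous_on {0..1} f" "mono_on {0..1} f \<or> antimono_on {0..1} f"
  shows "continuous_on {0..1} ((gauss_op ^^ n) f) \<and>
    (mono_on {0..1} ((gauss_op ^^ n) f) \<or> antimono_on {0..1} ((gauss_op ^^ n) f)) \<and>
    \<bar>(gauss_op ^^ n) f 0 - (gauss_op ^^ n) f 1\<bar> \<le> \<bar>f 0 - f 1\<bar> / 2 ^ n \<and>
    gauss_integral ((gauss_op ^^ n) f) = gauss_integral f"
proof (induction n)
  case 0 show ?case using assms by simp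
next
  case (Suc n)
  then show ?case
    using gauss_op_oscillation[of "(gauss_op ^^ n) f"]
    by (auto simp: gauss_op_invariant gauss_op_mono_on gauss_op_antimono
        intro: continuous_on_gauss_op)
qed

lemma has_integral_gauss_density: "((\<lambda>x. 1 / (1 + x)) has_integral ln 2) {0..1::real}"
proof -
  have "((\<lambda>x. 1 / (1 + x)) has_integral (ln (1 + 1) - ln (1 + 0))) {0..1::real}"
    by (rule fundamental_theorem_of_calculus)
      (auto simp: has_real_derivative_iff_has_vector_derivative[symmetric]
        intro!: derivative_eq_intros)
  then show ?thesis by simp
qed

text \<open>A monotone iterate exceeds its value at \<open>x\<close> nowhere by more than its
  oscillation. Integrating this bound against the Gauss density of mass \<open>ln 2\<close> compares
  it with the invariant integral.\<close>

lemma gauss_op_iterate_ge_mean: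
  assumes f: "continuous_on {0..1} f" "mono_on {0..1} f \<or> antimono_on {0..1} f"
    and x: "x \<in> {0..1}"
  shows "gauss_integral f \<le> ln 2 * ((gauss_op ^^ n) f x + \<bar>f 0 - f 1\<bar> / 2 ^ n)"
proof -
  define V where "V = (gauss_op ^^ n) f"
  define M where "M = V x + \<bar>f 0 - f 1\<bar> / 2 ^ n"
  have V: "continuous_on {0..1} V" "mono_on {0..1} V \<or> antimono_on {0..1} V"
    "\<bar>V 0 - V 1\<bar> \<le> \<bar>f 0 - f 1\<bar> / 2 ^ n" "gauss_integral V = gauss_integral f"
    using gauss_op_iterate[OF f, of n] by (auto simp: V_def)
  have "V y \<le> M" if "y \<in> {0..1}" for y
    using V(2)
  proof
    assume m: "mono_on {0..1} V"
    show ?thesis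
      using V(3) monotone_onD[OF m, of 0 x] monotone_onD[OF m, of y 1] x that by (auto simp: M_def)
  next
    assume m: "antimono_on {0..1} V"
    show ?thesis
      using V(3) monotone_onD[OF m, of x 1] monotone_onD[OF m, of 0 y] x that by (auto simp: M_def)
  qed
  then have le: "V y / (1 + y) \<le> M * (1 / (1 + y))" if "y \<in> {0..1}" for y
    using that by (auto intro!: divide_right_mono)
  have "(\<lambda>y. V y / (1 + y)) integrable_on {0..1}"
    by (intro integrable_continuous_real continuous_intros V(1)) auto
  then have "((\<lambda>y. V y / (1 + y)) has_integral gauss_integral V) {0..1}"
    unfolding gauss_integral_def by (rule integrable_integral)
  from has_integral_le[OF this has_integral_mult_right[OF has_integral_gauss_density] le]
  show ?thesis unfolding V(4) by (simp add: M_def V_def mult.commute)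
qed

section \<open>The mean of the truncated logarithm\<close>

text \<open>Flattening below \<open>c\<close> makes the function continuous and bounded on the
  closed interval; since it stays below \<open>- ln y\<close> for positive \<open>y\<close>, it
  still bounds \<open>y powr t\<close> from above.\<close>

definition trunc_log :: "real \<Rightarrow> real \<Rightarrow> real" where
  "trunc_log c y = - ln (max y c)"

lemma continuous_on_trunc_log: "0 < c \<Longrightarrow> continuous_on {0..1} (trunc_log c)"
  unfolding trunc_log_def by (intro continuous_intros) auto

lemma antimono_on_trunc_log: "0 < c \<Longrightarrow> antimono_on {0..1} (trunc_log c)"
  unfolding trunc_log_def by (auto simp: monotone_on_def)

lemma trunc_log_bounds: "0 < c \<Longrightarrow> c \<le> 1 \<Longrightarrow> y \<in> {0..1} \<Longrightarrow> 0 \<le> trunc_log c y \<and> trunc_log c y \<le> - ln c"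
  unfolding trunc_log_def by auto

lemma powr_le_exp_trunc_log:
  assumes "0 < c" "0 \<le> y" "0 \<le> t"
  shows "y powr t \<le> exp (- (t * trunc_log c y))"
proof -
  have "y powr t \<le> max y c powr t" using assms by (intro powr_mono2) auto
  then show ?thesis using assms by (simp add: trunc_log_def powr_def max_def split: if_splits)
qed

text \<open>Flipping the sign of the terms with even denominator subtracts twice a quarter of the
  Basel sum, which leaves half of it.\<close>

lemma alternating_partial_sum_tendsto:
  "(\<lambda>N. \<Sum>k<2 * N. (- 1) ^ k / (real k + 1)\<^sup>2) \<longlonglongrightarrow> pi\<^sup>2 / 12"
proof -
  define S where "S = (\<lambda>n. \<Sum>k<n. 1 / (real k + 1)\<^sup>2)"
  have S: "S \<longlonglongrightarrow> pi\<^sup>2 / 6"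
    using inverse_squares_sums by (simp add: S_def[abs_def] sums_def add.commute)
  have "(\<lambda>N. S (2 * N)) \<longlonglongrightarrow> pi\<^sup>2 / 6"
    using LIMSEQ_subseq_LIMSEQ[OF S, of "\<lambda>N. 2 * N"] by (auto simp: strict_mono_def o_def)
  from tendsto_diff[OF this tendsto_divide[OF S tendsto_const[of 2]]]
  have "(\<lambda>N. S (2 * N) - S N / 2) \<longlonglongrightarrow> pi\<^sup>2 / 12" by simp
  moreover have "(\<Sum>k<2 * N. (- 1) ^ k / (real k + 1)\<^sup>2) = S (2 * N) - S N / 2" for N
  proof (induction N)
    case (Suc N)
    have "1 / (2 * real N + 2)\<^sup>2 = 1 / (4 * (real N + 1)\<^sup>2)"
      by (simp add: power2_eq_square algebra_simps)
    then show ?case using Suc by (simp add: S_def add_divide_distrib add.commute)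
  qed (simp add: S_def)
  ultimately show ?thesis by simp
qed

text \<open>An even number of terms falls short of the full value by
  \<open>x ^ (2 * N) / (1 + x)\<close>, which is nonnegative.\<close>

lemma geometric_alternating_le:
  fixes x :: real
  assumes "0 \<le> x"
  shows "(\<Sum>k<2 * N. (- x) ^ k) \<le> 1 / (1 + x)"
proof -
  have "(1 + x) * (\<Sum>k<n. (- x) ^ k) = 1 - (- x) ^ n" for n
    by (induction n) (auto simp: algebra_simps)
  then have "(1 + x) * (\<Sum>k<2 * N. (- x) ^ k) = 1 - (x ^ 2) ^ N"
    by (simp add: power_mult)
  also have "\<dots> \<le> 1" by simp
  finally show ?thesis using assms by (simp add: field_simps)
qed

text \<open>Replace \<open>1 / (1 + x)\<close> from below by an even partial sum of the geometric
  series. Each \<open>- (x ^ k * ln x)\<close> has integral \<open>1 / (k + 1)^2\<close> over (0,1),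
  and a small cutoff \<open>c\<close> loses arbitrarily little, so only proper integrals over
  \<open>{c..1}\<close> occur.\<close>

lemma gauss_integral_trunc_log:
  assumes "m < pi\<^sup>2 / 12"
  shows "\<exists>c. 0 < c \<and> c < 1 \<and> m < gauss_integral (trunc_log c)"
proof -
  obtain N where N: "m < (\<Sum>k<2 * N. (- 1) ^ k / (real k + 1)\<^sup>2)"
    using order_tendstoD(1)[OF alternating_partial_sum_tendsto assms]
    by (auto simp: eventually_sequentially)
  \<comment> \<open>The antiderivative of \<open>- (x ^ k * ln x)\<close> that tends to 0 at 0; its
    value at 1 is the \<open>k\<close>-th term of the sum without the sign.\<close>
  define F where "F = (\<lambda>k::nat. \<lambda>x::real. x ^ (k + 1) / (real k + 1)\<^sup>2 - x ^ (k + 1) * ln x / (real k + 1))"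
  define H where "H = (\<lambda>x. \<Sum>k<2 * N. (- 1) ^ k * F k x)"
  have H1: "H 1 = (\<Sum>k<2 * N. (- 1) ^ k / (real k + 1)\<^sup>2)" by (simp add: H_def F_def)
  have "(H \<longlongrightarrow> (\<Sum>k<2 * N. (- 1) ^ k * (0 ^ (k + 1) / (real k + 1)\<^sup>2 - 0 ^ k * 0 / (real k + 1)))) (at_right 0)"
  proof -
    have xl: "((\<lambda>x::real. x * ln x) \<longlongrightarrow> 0) (at_right 0)" by real_asymp
    have F: "F k x = x ^ (k + 1) / (real k + 1)\<^sup>2 - x ^ k * (x * ln x) / (real k + 1)" for k x
      by (simp add: F_def)
    show ?thesis unfolding H_def F by (intro tendsto_intros xl) auto
  qed
  then have "((\<lambda>c. H 1 - H c) \<longlongrightarrow> H 1 - 0) (at_right 0)" by (intro tendsto_intros) simp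
  then have "\<forall>\<^sub>F c in at_right 0. m < H 1 - H c"
    using N H1 by (intro order_tendstoD(1)) auto
  moreover have "\<forall>\<^sub>F c in at_right 0. c \<in> {0<..<1::real}"
    by (rule eventually_at_right_real) simp
  ultimately obtain c where c: "m < H 1 - H c" "0 < c" "c < 1"
    using eventually_happens[of "\<lambda>c. m < H 1 - H c \<and> c \<in> {0<..<1::real}" "at_right 0"]
    by (auto simp: eventually_conj_iff)
  have "((\<lambda>x. \<Sum>k<2 * N. (- 1) ^ k * (- (x ^ k * ln x))) has_integral H 1 - H c) {c..1}"
  proof (rule fundamental_theorem_of_calculus)
    fix x assume x: "x \<in> {c..1}"
    have "(F k has_real_derivative - (x ^ k * ln x)) (at x within {c..1})" for k
    proof -
      have p: "((\<lambda>x. x ^ (k + 1)) has_real_derivative (real k + 1) * x ^ k) (at x within {c..1})"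
        by (rule DERIV_cong[OF DERIV_pow]) simp
      have l: "(ln has_real_derivative 1 / x) (at x within {c..1})"
        using x c by (auto intro!: derivative_eq_intros)
      have "(real k + 1) * x ^ k / (real k + 1)\<^sup>2 -
          ((real k + 1) * x ^ k * ln x + 1 / x * x ^ (k + 1)) / (real k + 1) = - (x ^ k * ln x)"
        using x c by (simp add: power2_eq_square add_divide_distrib)
      with DERIV_diff[OF DERIV_cdivide[OF p] DERIV_cdivide[OF DERIV_mult[OF p l]]]
      show ?thesis unfolding F_def by (rule DERIV_cong)
    qed
    then show "(H has_vector_derivative (\<Sum>k<2 * N. (- 1) ^ k * (- (x ^ k * ln x)))) (at x within {c..1})"
      unfolding has_real_derivative_iff_has_vector_derivative[symmetric] H_def
      by (intro derivative_intros DERIV_cmult)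
  qed (use c in auto)
  moreover have "(\<lambda>x::real. \<Sum>k<2 * N. (- 1) ^ k * (- (x ^ k * ln x))) =
      (\<lambda>x. (\<Sum>k<2 * N. (- x) ^ k) * - ln x)"
  proof
    fix x :: real
    show "(\<Sum>k<2 * N. (- 1) ^ k * (- (x ^ k * ln x))) = (\<Sum>k<2 * N. (- x) ^ k) * - ln x"
      by (simp add: sum_distrib_right power_minus[of x] sum_negf mult.assoc)
  qed
  ultimately have int: "((\<lambda>x. (\<Sum>k<2 * N. (- x) ^ k) * - ln x) has_integral H 1 - H c) {c..1}"
    by (simp only:)
  define d where "d = (\<lambda>x. trunc_log c x / (1 + x))"
  have d: "d integrable_on {0..1}"
    unfolding d_def by (intro integrable_continuous_real continuous_intros continuous_on_trunc_log c) auto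
  have d': "d integrable_on {c..1}"
    by (rule integrable_on_subinterval[OF d]) (use c in auto)
  have "H 1 - H c \<le> integral {c..1} d"
  proof (rule has_integral_le[OF int integrable_integral[OF d']])
    fix x assume x: "x \<in> {c..1}"
    have "(\<Sum>k<2 * N. (- x) ^ k) * - ln x \<le> 1 / (1 + x) * - ln x"
      using x c by (intro mult_right_mono geometric_alternating_le) auto
    also have "\<dots> = d x" using x by (simp add: d_def trunc_log_def max_absorb1)
    finally show "(\<Sum>k<2 * N. (- x) ^ k) * - ln x \<le> d x" .
  qed
  also have "\<dots> \<le> integral {0..1} d"
    by (rule integral_subset_le[OF _ d' d])
      (use c trunc_log_bounds[of c] in \<open>auto simp: d_def\<close>)
  finally show ?thesis using c by (auto simp: gauss_integral_def d_def)
qed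

text \<open>The midpoint \<open>m'\<close> splits the gap: truncation keeps the normalised mean
  above \<open>m'\<close>, and for a late iterate the oscillation is below
  \<open>m' - m\<close>.\<close>

lemma iterate_trunc_log_ge:
  assumes "m < levy_const"
  shows "\<exists>c N. 0 < c \<and> c < 1 \<and> (\<forall>x\<in>{0..1}. m \<le> (gauss_op ^^ Suc N) (trunc_log c) x)"
proof -
  define m' where "m' = (m + levy_const) / 2"
  have m': "m < m'" "m' < levy_const" using assms by (auto simp: m'_def)
  have "m' * ln 2 < pi\<^sup>2 / 12" using m'(2) by (simp add: levy_const_def field_simps)
  from gauss_integral_trunc_log[OF this]
  obtain c where c: "0 < c" "c < 1" "m' * ln 2 < gauss_integral (trunc_log c)" by auto
  define A where "A = \<bar>trunc_log c 0 - trunc_log c 1\<bar>"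
  have "(\<lambda>n. A / 2 ^ n) \<longlonglongrightarrow> 0" by real_asymp
  from order_tendstoD(2)[OF this, of "m' - m"] m'
  obtain N where N: "\<And>n. n \<ge> N \<Longrightarrow> A / 2 ^ n < m' - m" by (auto simp: eventually_sequentially)
  have "m \<le> (gauss_op ^^ Suc N) (trunc_log c) x" if x: "x \<in> {0..1}" for x
  proof -
    have "m' * ln 2 \<le> ((gauss_op ^^ Suc N) (trunc_log c) x + A / 2 ^ Suc N) * ln 2"
      using gauss_op_iterate_ge_mean[OF continuous_on_trunc_log[OF c(1)] disjI2[OF antimono_on_trunc_log[OF c(1)]] x, of "Suc N"] c(3)
      unfolding A_def by (simp only: mult.commute)
    then have "m' \<le> (gauss_op ^^ Suc N) (trunc_log c) x + A / 2 ^ Suc N"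
      by (rule mult_right_le_imp_le) simp
    then show ?thesis using N[of "Suc N"] by linarith
  qed
  then show ?thesis using c by blast
qed

section \<open>A strict subsolution for the perturbed operator\<close>

text \<open>From \<open>exp u \<ge> 1 + u\<close> and
  \<open>(1 + u) * (1 - u + u^2) = 1 + u^3\<close>.\<close>

lemma exp_minus_le_quadratic:
  fixes u :: real
  assumes "0 \<le> u"
  shows "exp (- u) \<le> 1 - u + u\<^sup>2"
proof -
  have "exp (- u) \<le> 1 / (1 + u)"
    using exp_ge_add_one_self[of u] assms by (simp add: exp_minus field_simps)
  also have "\<dots> \<le> 1 - u + u\<^sup>2"
    using assms by (simp add: divide_simps power2_eq_square algebra_simps)
  finally show ?thesis .
qed

text \<open>To first order in \<open>t\<close> the image of \<open>1 + t * \<phi>\<close> is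
  \<open>1 + t * (gauss_op \<phi> - gauss_op f)\<close>, and the Poisson equation bounds the bracket
  by \<open>\<phi> - m'\<close>. The slack \<open>m' - m\<close> then absorbs the quadratic error.
  The bounds 1 and \<open>B\<close> on \<open>g\<close> later make weighted and unweighted sums
  comparable.\<close>

lemma lyapunov_function:
  assumes "m < levy_const"
  shows "\<exists>t g B. 0 < t \<and> 0 < 1 - t * m \<and> (\<forall>x\<in>{0..1}. 1 \<le> g x \<and> g x \<le> B \<and>
    gauss_op (\<lambda>y. y powr t * g y) x \<le> (1 - t * m) * g x)"
proof -
  define m' where "m' = (m + levy_const) / 2"
  have m': "m < m'" "m' < levy_const" using assms by (auto simp: m'_def)
  from iterate_trunc_log_ge[OF m'(2)] obtain c N where c: "0 < c" "c < 1"
    and N: "\<And>x. x \<in> {0..1} \<Longrightarrow> m' \<le> (gauss_op ^^ Suc N) (trunc_log c) x" by blast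
  define f where "f = trunc_log c"
  define V where "V = (\<lambda>n. (gauss_op ^^ n) f)"
  define K where "K = - ln c"
  define B where "B = real N * K"
  define C where "C = K\<^sup>2 * (1 + B)"
  \<comment> \<open>Minus the sum of the iterates solves the equation up to the last iterate,
    because the sum telescopes under the operator. Constants are fixed, so the shift by
    \<open>B\<close> is free and makes \<open>\<phi>\<close> nonnegative.\<close>
  define \<phi> where "\<phi> = (\<lambda>x. B - (\<Sum>j<N. V (Suc j) x))"
  have K: "0 \<le> K" using c by (simp add: K_def)
  have B: "0 \<le> B" using K by (simp add: B_def)
  have C: "0 \<le> C" using B by (simp add: C_def)
  have f: "0 \<le> f y" "f y \<le> K" if "y \<in> {0..1}" for y
    using trunc_log_bounds[of c y] c that by (auto simp: f_def K_def)
  have V: "0 \<le> V n y" "V n y \<le> K" if "y \<in> {0..1}" for n y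
    using gauss_op_iterate_bounds[of 0 f K y n] f that by (auto simp: V_def)
  have sumV: "0 \<le> (\<Sum>j<N. V (Suc j) x)" "(\<Sum>j<N. V (Suc j) x) \<le> B" if "x \<in> {0..1}" for x
    using V[OF that] sum_bounded_above[of "{..<N}" "\<lambda>j. V (Suc j) x" K]
    by (auto simp: B_def intro: sum_nonneg)
  have \<phi>: "0 \<le> \<phi> x" "\<phi> x \<le> B" if "x \<in> {0..1}" for x
    using sumV[OF that] by (auto simp: \<phi>_def)
  have poisson: "gauss_op \<phi> x = \<phi> x + V 1 x - V (Suc N) x" if x: "x \<in> {0..1}" for x
  proof -
    have "gauss_op (\<lambda>y. \<Sum>j<N. - V (Suc j) y) x = (\<Sum>j<N. gauss_op (\<lambda>y. - V (Suc j) y) x)"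
      by (rule gauss_op_sum[where M = K]) (use x V in auto)
    also have "\<dots> = (\<Sum>j<N. - V (Suc (Suc j)) x)"
    proof (rule sum.cong[OF refl])
      fix j
      have "\<bar>V (Suc j) y\<bar> \<le> K" if "y \<in> {0..1}" for y using V[OF that] by auto
      from gauss_op_cmult[of x "V (Suc j)" K "-1", OF _ this] x
      show "gauss_op (\<lambda>y. - V (Suc j) y) x = - V (Suc (Suc j)) x" by (simp add: V_def)
    qed
    also have "\<dots> = V 1 x - V (Suc N) x - (\<Sum>j<N. V (Suc j) x)"
      by (induction N) auto
    finally have "gauss_op (\<lambda>y. B + (\<Sum>j<N. - V (Suc j) y)) x =
        B + (V 1 x - V (Suc N) x - (\<Sum>j<N. V (Suc j) x))"
      using gauss_op_add[of x "\<lambda>_. B" B "\<lambda>y. \<Sum>j<N. - V (Suc j) y" B] x sumV B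
      by (auto simp: gauss_op_const sum_negf abs_le_iff)
    then show ?thesis by (simp add: \<phi>_def sum_negf)
  qed
  \<comment> \<open>Coefficient of the second-order errors: \<open>C\<close> comes from expanding
    \<open>y powr t\<close>, \<open>\<bar>m\<bar> * B\<close> from the cross term of
    \<open>(1 - t * m) * (1 + t * \<phi> x)\<close>, and 1 keeps it positive.\<close>
  define D where "D = C + \<bar>m\<bar> * B + 1"
  have D: "0 < D" using C B by (simp add: D_def add_nonneg_pos)
  \<comment> \<open>The three bounds on \<open>t\<close> serve the crude estimates, the error
    \<open>t * D \<le> m' - m\<close>, and \<open>t * m \<le> 1 / 2\<close>.\<close>
  define t where "t = min 1 (min ((m' - m) / D) (1 / (2 * (\<bar>m\<bar> + 1))))"
  have t: "0 < t" "t \<le> 1" using m' D by (auto simp: t_def)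
  have tD: "t * D \<le> m' - m"
    using D by (simp add: t_def pos_le_divide_eq[symmetric])
  have tm: "0 < 1 - t * m"
  proof -
    have "t * m \<le> t * (\<bar>m\<bar> + 1)" using t by (intro mult_left_mono) auto
    also have "\<dots> \<le> 1 / (2 * (\<bar>m\<bar> + 1)) * (\<bar>m\<bar> + 1)"
      unfolding t_def by (intro mult_right_mono) auto
    also have "\<dots> = 1 / 2" by (simp add: field_simps)
    finally show ?thesis by simp
  qed
  have step: "gauss_op (\<lambda>y. y powr t * (1 + t * \<phi> y)) x \<le> (1 - t * m) * (1 + t * \<phi> x)"
    if x: "x \<in> {0..1}" for x
  proof -
    \<comment> \<open>First-order expansion with the remainder collected in
      \<open>t\<^sup>2 * C\<close>; the product \<open>f y * \<phi> y\<close> enters with a minus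
      sign and is dropped.\<close>
    have pt: "y powr t * (1 + t * \<phi> y) \<le> (1 + t\<^sup>2 * C) + (t * \<phi> y + - t * f y)" if y: "y \<in> {0..1}" for y
    proof -
      have "y powr t \<le> exp (- (t * f y))"
        unfolding f_def using c y t by (intro powr_le_exp_trunc_log) auto
      also have "\<dots> \<le> 1 - t * f y + (t * f y)\<^sup>2"
        using t f[OF y] by (intro exp_minus_le_quadratic) auto
      finally have "y powr t * (1 + t * \<phi> y) \<le> (1 - t * f y + (t * f y)\<^sup>2) * (1 + t * \<phi> y)"
        using t \<phi>[OF y] by (intro mult_right_mono) auto
      also have "\<dots> = 1 + (t * \<phi> y - t * f y) + t\<^sup>2 * ((f y)\<^sup>2 * (1 + t * \<phi> y) - f y * \<phi> y)"
        by (simp add: power2_eq_square algebra_simps)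
      also have "(f y)\<^sup>2 * (1 + t * \<phi> y) \<le> C"
        unfolding C_def
        using f[OF y] \<phi>[OF y] t mult_mono[of t 1 "\<phi> y" B] by (intro mult_mono power_mono) auto
      then have "t\<^sup>2 * ((f y)\<^sup>2 * (1 + t * \<phi> y) - f y * \<phi> y) \<le> t\<^sup>2 * C"
        using f[OF y] \<phi>[OF y] by (intro mult_left_mono) (auto intro: order_trans[rotated])
      finally show ?thesis by simp
    qed
    have b1: "\<bar>t * \<phi> y\<bar> \<le> B" "\<bar>- t * f y\<bar> \<le> K" if "y \<in> {0..1}" for y
      using \<phi>[OF that] f[OF that] t mult_mono[of t 1 "\<phi> y" B] mult_mono[of t 1 "f y" K]
      by (auto simp: abs_mult)
    have b2: "\<bar>t * \<phi> y + - t * f y\<bar> \<le> B + K" if "y \<in> {0..1}" for y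
      using b1[OF that] by linarith
    have b3: "\<bar>(1 + t\<^sup>2 * C) + (t * \<phi> y + - t * f y)\<bar> \<le> (1 + t\<^sup>2 * C) + (B + K)" if "y \<in> {0..1}" for y
      using b2[OF that] mult_nonneg_nonneg[OF zero_le_power2[of t] C] by linarith
    have b4: "\<bar>y powr t * (1 + t * \<phi> y)\<bar> \<le> 1 + B" if "y \<in> {0..1}" for y
    proof -
      have "y powr t * (1 + t * \<phi> y) \<le> 1 * (1 + B)"
        using that t \<phi>[OF that] b1(1)[OF that] powr_le1[of t y] by (intro mult_mono) auto
      then show ?thesis using t \<phi>[OF that] by simp
    qed
    have "gauss_op (\<lambda>y. y powr t * (1 + t * \<phi> y)) x \<le>
        gauss_op (\<lambda>y. (1 + t\<^sup>2 * C) + (t * \<phi> y + - t * f y)) x"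
      by (rule gauss_op_mono[OF _ b4 b3 pt]) (use x in auto)
    also have "\<dots> = (1 + t\<^sup>2 * C) + (t * gauss_op \<phi> x + - t * gauss_op f x)"
    proof -
      have "\<bar>\<phi> y\<bar> \<le> B" "\<bar>f y\<bar> \<le> K" if "y \<in> {0..1}" for y using \<phi>[OF that] f[OF that] by auto
      then show ?thesis
        using x gauss_op_add[of x "\<lambda>_. 1 + t\<^sup>2 * C" "\<bar>1 + t\<^sup>2 * C\<bar>" "\<lambda>y. t * \<phi> y + - t * f y" "B + K"]
          gauss_op_add[of x "\<lambda>y. t * \<phi> y" B "\<lambda>y. - t * f y" K] b1 b2
          gauss_op_cmult[of x \<phi> B t] gauss_op_cmult[of x f K "- t"]
        by (simp add: gauss_op_const)
    qed
    also have "\<dots> = 1 + t * \<phi> x - t * V (Suc N) x + t * (t * C)"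
    proof -
      have "gauss_op f x = V 1 x" by (simp add: V_def)
      then show ?thesis by (simp add: poisson[OF x] power2_eq_square algebra_simps)
    qed
    also have "\<dots> \<le> 1 + t * \<phi> x - t * m' + t * (t * C)"
      using N[OF x] t by (auto simp: V_def f_def)
    also have "\<dots> \<le> (1 - t * m) * (1 + t * \<phi> x)"
    proof -
      have "m * \<phi> x \<le> \<bar>m\<bar> * B" using \<phi>[OF x] by (intro mult_mono) auto
      then have "t * (C + m * \<phi> x) \<le> t * D" using t by (intro mult_left_mono) (auto simp: D_def)
      then have "t * (C + m * \<phi> x) \<le> m' - m" using tD by linarith
      then have "t * (t * (C + m * \<phi> x)) \<le> t * (m' - m)" using t by (intro mult_left_mono) auto
      then show ?thesis by (simp add: algebra_simps)
    qed
    finally show ?thesis .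
  qed
  have "1 \<le> 1 + t * \<phi> x \<and> 1 + t * \<phi> x \<le> 1 + t * B" if "x \<in> {0..1}" for x
    using \<phi>[OF that] t by auto
  then show ?thesis using t tm step
    by (intro exI[of _ t] exI[of _ "\<lambda>x. 1 + t * \<phi> x"] exI[of _ "1 + t * B"]) auto
qed

subsection \<open>Denominators and the pressure function\<close>

text \<open>The value 0 at \<open>n = 0\<close> is the convention for the denominator of index -1;
  it makes the recursion uniform in \<open>n\<close>.\<close>

definition cf_prev :: "(nat \<Rightarrow> nat) \<Rightarrow> nat \<Rightarrow> nat" where
  "cf_prev a n = (case n of 0 \<Rightarrow> 0 | Suc m \<Rightarrow> cf_denom a m)"

lemma cf_prev_simps [simp]: "cf_prev a 0 = 0" "cf_prev a (Suc n) = cf_denom a n"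
  by (simp_all add: cf_prev_def)

lemma cf_denom_Suc: "cf_denom a (Suc n) = a (Suc n) * cf_denom a n + cf_prev a n"
  by (cases n) auto

declare cf_denom.simps(2,3) [simp del]

lemma cf_denom_cong:
  assumes "\<And>i. i \<in> {1..n} \<Longrightarrow> a i = b i"
  shows "cf_denom a n = cf_denom b n \<and> cf_prev a n = cf_prev b n"
  using assms by (induction n) (auto simp: cf_denom_Suc)

lemma cf_denom_pos:
  assumes "\<And>i. i \<in> {1..n} \<Longrightarrow> 1 \<le> a i"
  shows "1 \<le> cf_denom a n \<and> cf_prev a n \<le> cf_denom a n"
  using assms
proof (induction n)
  case (Suc n)
  then have IH: "1 \<le> cf_denom a n" "cf_prev a n \<le> cf_denom a n" and a: "1 \<le> a (Suc n)" by auto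
  have "1 * cf_denom a n \<le> a (Suc n) * cf_denom a n" using a by (intro mult_right_mono) auto
  then have "cf_denom a n \<le> cf_denom a (Suc n)" unfolding cf_denom_Suc by linarith
  then show ?case using IH by simp
qed simp

text \<open>The continuant identity for a concatenation has a further nonnegative summand, dropped
  here. The bound on previous denominators is carried along because the recursion has depth
  two.\<close>

lemma cf_denom_append:
  "cf_denom a m * cf_denom (\<lambda>i. a (m + i)) n \<le> cf_denom a (m + n) \<and>
   cf_denom a m * cf_prev (\<lambda>i. a (m + i)) n \<le> cf_prev a (m + n)"
proof (induction n)
  case (Suc n)
  have "cf_denom a m * cf_denom (\<lambda>i. a (m + i)) (Suc n) =
      a (Suc (m + n)) * (cf_denom a m * cf_denom (\<lambda>i. a (m + i)) n) +
      cf_denom a m * cf_prev (\<lambda>i. a (m + i)) n"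
    by (simp add: cf_denom_Suc algebra_simps)
  also have "\<dots> \<le> a (Suc (m + n)) * cf_denom a (m + n) + cf_prev a (m + n)"
    using Suc by (intro add_mono mult_left_mono) auto
  also have "\<dots> = cf_denom a (m + Suc n)"
    by (simp add: cf_denom_Suc)
  finally show ?case using Suc by simp
qed simp

lemma cf_denom_le_power:
  assumes "\<And>i. i \<in> {1..n} \<Longrightarrow> 1 \<le> a i \<and> a i \<le> M"
  shows "cf_denom a n \<le> (M + 1) ^ n"
  using assms
proof (induction n)
  case (Suc n)
  have "a (Suc n) * cf_denom a n \<le> M * (M + 1) ^ n" using Suc by (intro mult_mono) auto
  moreover have "cf_prev a n \<le> (M + 1) ^ n" 
    using cf_denom_pos[of n a] Suc by fastforce
  ultimately show ?case by (simp add: cf_denom_Suc)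
qed simp

section \<open>Sums over digit tuples and their submultiplicativity\<close>

text \<open>Capping the digits keeps the sums finite; bounds uniform in the cap pass to the infinite
  sum. The exponent \<open>s\<close> stands for \<open>2 * \<theta>\<close>.\<close>

definition box_sum :: "real \<Rightarrow> nat \<Rightarrow> nat \<Rightarrow> real" where
  "box_sum s n M = (\<Sum>a\<in>{1..n} \<rightarrow>\<^sub>E {1..M}. real (cf_denom a n) powr (- s))"

definition denom_sum :: "real \<Rightarrow> nat \<Rightarrow> real" where
  "denom_sum s n = (\<Sum>\<^sub>\<infinity>a\<in>({1..n} \<rightarrow>\<^sub>E {1..}). real (cf_denom a n) powr (- s))"

lemma box_finite: "finite ({1..n::nat} \<rightarrow>\<^sub>E {1..M::nat})"
  by (intro finite_PiE) auto

lemma sum_box_Suc: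
  "(\<Sum>a\<in>{1..Suc n} \<rightarrow>\<^sub>E {1..M::nat}. f a) =
   (\<Sum>a\<in>{1..n} \<rightarrow>\<^sub>E {1..M}. \<Sum>k\<in>{1..M}. f (a(Suc n := k)))"
proof -
  have inj: "inj_on (\<lambda>(y, g). g(Suc n := y)) ({1..M} \<times> ({1..n} \<rightarrow>\<^sub>E {1..M}))"
    by (rule inj_combinator) simp
  have ins: "{1..Suc n} = insert (Suc n) {1..n}" by auto
  have "(\<Sum>a\<in>{1..Suc n} \<rightarrow>\<^sub>E {1..M::nat}. f a) =
      (\<Sum>p\<in>{1..M} \<times> ({1..n} \<rightarrow>\<^sub>E {1..M}). f ((\<lambda>(y, g). g(Suc n := y)) p))"
    unfolding ins PiE_insert_eq sum.reindex[OF inj] o_def ..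
  also have "\<dots> = (\<Sum>k\<in>{1..M}. \<Sum>a\<in>{1..n} \<rightarrow>\<^sub>E {1..M}. f (a(Suc n := k)))"
    by (simp add: sum.cartesian_product case_prod_unfold)
  also have "\<dots> = (\<Sum>a\<in>{1..n} \<rightarrow>\<^sub>E {1..M}. \<Sum>k\<in>{1..M}. f (a(Suc n := k)))"
    by (rule sum.swap)
  finally show ?thesis .
qed

lemma box_sum_nonneg: "0 \<le> box_sum s n M"
  unfolding box_sum_def by (intro sum_nonneg) auto

text \<open>Cutting a tuple into its first \<open>m\<close> and last \<open>n\<close> digits is
  injective, and denominators are supermultiplicative, so their negative powers are
  submultiplicative.\<close>

lemma box_sum_add_le: 
  assumes "0 \<le> s"
  shows "box_sum s (m + n) M \<le> box_sum s m M * box_sum s n M"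
proof -
  define X where "X = (\<lambda>n::nat. {1..n} \<rightarrow>\<^sub>E {1..M::nat})"
  define p where "p = (\<lambda>a::nat \<Rightarrow> nat. (restrict a {1..m}, restrict (\<lambda>i. a (m + i)) {1..n}))"
  define g where "g = (\<lambda>(a, b). real (cf_denom a m) powr (- s) * real (cf_denom b n) powr (- s))"
  have p: "p ` X (m + n) \<subseteq> X m \<times> X n"
  proof
    fix z assume "z \<in> p ` X (m + n)"
    then obtain a where a: "a \<in> X (m + n)" "z = p a" by blast
    then have "a i \<in> {1..M}" if "i \<in> {1..m + n}" for i
      using that PiE_mem[of a "{1..m + n}" "\<lambda>_. {1..M}" i] unfolding X_def by blast
    then have "fst (p a) \<in> X m" "snd (p a) \<in> X n"
      unfolding p_def X_def by (simp_all add: restrict_PiE_iff)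
    then show "z \<in> X m \<times> X n" unfolding a(2) by (simp add: mem_Times_iff)
  qed
  have inj: "inj_on p (X (m + n))"
  proof (rule inj_onI)
    fix a b assume ab: "a \<in> X (m + n)" "b \<in> X (m + n)" "p a = p b"
    show "a = b"
    proof
      fix i
      consider "i \<in> {1..m}" | j where "j \<in> {1..n}" "i = m + j" | "i \<notin> {1..m + n}"
      proof (cases "i \<in> {1..m} \<or> i \<notin> {1..m + n}")
        case False
        then have "i - m \<in> {1..n}" "i = m + (i - m)" by auto
        then show ?thesis using that(2) by blast
      qed (use that in blast)
      then show "a i = b i"
      proof cases
        case 1
        have "restrict a {1..m} i = restrict b {1..m} i" using ab(3) by (simp add: p_def)
        then show ?thesis using 1 by simp
      next
        case 2 
        have "restrict (\<lambda>i. a (m + i)) {1..n} j = restrict (\<lambda>i. b (m + i)) {1..n} j"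
          using ab(3) by (simp add: p_def)
        then show ?thesis using 2 by simp
      next
        case 3
        then show ?thesis using ab(1,2) PiE_arb[of _ "{1..m + n}" "\<lambda>_. {1..M}" i]
          unfolding X_def by metis
      qed
    qed
  qed
  have "box_sum s (m + n) M \<le> (\<Sum>a\<in>X (m + n). g (p a))"
    unfolding box_sum_def X_def
  proof (rule sum_mono)
    fix a assume a: "a \<in> {1..m + n} \<rightarrow>\<^sub>E {1..M}"
    have a1: "1 \<le> a i" if "i \<in> {1..m + n}" for i using a that by (auto simp: PiE_iff)
    have q: "cf_denom (fst (p a)) m = cf_denom a m" "cf_denom (snd (p a)) n = cf_denom (\<lambda>i. a (m + i)) n"
      by (rule conjunct1[OF cf_denom_cong], simp add: p_def)+
    have pos: "1 \<le> cf_denom a m" "1 \<le> cf_denom (\<lambda>i. a (m + i)) n"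
      by (rule conjunct1[OF cf_denom_pos], rule a1, simp)+
    have "0 < real (cf_denom a m) * real (cf_denom (\<lambda>i. a (m + i)) n)" using pos by simp
    moreover have "real (cf_denom a m) * real (cf_denom (\<lambda>i. a (m + i)) n) \<le> real (cf_denom a (m + n))"
      unfolding of_nat_mult[symmetric] of_nat_le_iff using cf_denom_append[of a m n] by blast
    ultimately have "real (cf_denom a (m + n)) powr (- s) \<le>
        (real (cf_denom a m) * real (cf_denom (\<lambda>i. a (m + i)) n)) powr (- s)"
      using assms by (intro powr_mono2') auto
    also have "\<dots> = g (p a)"
      using q by (simp add: g_def case_prod_unfold powr_mult)
    finally show "real (cf_denom a (m + n)) powr (- s) \<le> g (p a)" .
  qed
  also have "\<dots> = sum g (p ` X (m + n))" by (simp add: sum.reindex[OF inj])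
  also have "\<dots> \<le> sum g (X m \<times> X n)"
    by (rule sum_mono2[OF _ p])
      (auto simp: X_def g_def intro!: finite_cartesian_product box_finite[unfolded One_nat_def])
  also have "\<dots> = box_sum s m M * box_sum s n M"
    by (simp add: g_def X_def box_sum_def sum_product sum.cartesian_product)
  finally show ?thesis .
qed

lemma finite_subset_box:
  assumes "finite F" "F \<subseteq> {1..n::nat} \<rightarrow>\<^sub>E {1::nat..}"
  obtains M where "F \<subseteq> {1..n} \<rightarrow>\<^sub>E {1..M}"
proof -
  have "finite (\<Union>a\<in>F. a ` {1..n})" using assms by auto
  then obtain M where M: "\<forall>k\<in>(\<Union>a\<in>F. a ` {1..n}). k \<le> M"
    by (auto simp: finite_nat_set_iff_bounded_le)
  have "F \<subseteq> {1..n} \<rightarrow>\<^sub>E {1..M}"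
  proof
    fix a assume a: "a \<in> F"
    then have aP: "a \<in> {1..n} \<rightarrow>\<^sub>E {1..}" using assms by blast
    show "a \<in> {1..n} \<rightarrow>\<^sub>E {1..M}"
    proof (rule PiE_I)
      show "a i \<in> {1..M}" if "i \<in> {1..n}" for i
        using PiE_mem[OF aP that] M a that by simp
      show "a i = undefined" if "i \<notin> {1..n}" for i using PiE_arb[OF aP that] .
    qed
  qed
  then show ?thesis using that by blast
qed

text \<open>Every finite set of tuples lies in some box, so a bound uniform in \<open>M\<close>
  controls all finite partial sums.\<close>

lemma denom_sum_le:
  assumes "\<And>M. box_sum s n M \<le> C"
  shows "(\<lambda>a. real (cf_denom a n) powr (- s)) summable_on ({1..n} \<rightarrow>\<^sub>E {1..})"
    and "denom_sum s n \<le> C"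
proof -
  have le: "(\<Sum>a\<in>F. real (cf_denom a n) powr (- s)) \<le> C"
    if F: "finite F" "F \<subseteq> {1..n} \<rightarrow>\<^sub>E {1..}" for F
  proof -
    obtain M where "F \<subseteq> {1..n} \<rightarrow>\<^sub>E {1..M}" using finite_subset_box[OF F] .
    then have "(\<Sum>a\<in>F. real (cf_denom a n) powr (- s)) \<le> box_sum s n M"
      unfolding box_sum_def by (intro sum_mono2 box_finite) auto
    then show ?thesis using assms[of M] by linarith
  qed
  then show s: "(\<lambda>a. real (cf_denom a n) powr (- s)) summable_on ({1..n} \<rightarrow>\<^sub>E {1..})"
    by (intro nonneg_bdd_above_summable_on) (auto simp: bdd_above_def)
  show "denom_sum s n \<le> C"
    unfolding denom_sum_def by (rule infsum_le_finite_sums[OF s le])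
qed

lemma box_sum_bounded:
  assumes "1 < s"
  shows "\<exists>C. \<forall>M. box_sum s n M \<le> C"
proof (induction n)
  case 0 show ?case by (auto simp: box_sum_def)
next
  case (Suc n)
  then obtain C where C: "\<And>M. box_sum s n M \<le> C" by auto
  have sm: "summable (\<lambda>k. real k powr (- s))"
    using assms by (simp add: summable_real_powr_iff)
  \<comment> \<open>The term at \<open>k = 0\<close> is 0, since
    \<open>0 powr (- s) = 0\<close>.\<close>
  define Z where "Z = (\<Sum>k. real k powr (- s))"
  have "box_sum s 1 M \<le> Z" for M
  proof -
    have "box_sum s 1 M = (\<Sum>k\<in>{1..M}. real k powr (- s))"
      using sum_box_Suc[of "\<lambda>a. real (cf_denom a (Suc 0)) powr - s" 0 M]
      by (simp add: box_sum_def cf_denom_Suc)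
    also have "\<dots> \<le> Z"
      unfolding Z_def by (rule sum_le_suminf[OF sm]) auto
    finally show ?thesis .
  qed
  moreover have "0 \<le> C" using C[of 0] box_sum_nonneg[of s n 0] by linarith
  ultimately have "box_sum s n M * box_sum s 1 M \<le> C * Z" for M
    using C box_sum_nonneg by (intro mult_mono) auto
  then have "box_sum s (n + 1) M \<le> C * Z" for M
    using order_trans[OF box_sum_add_le[of s n 1 M]] assms by simp
  then show ?case by auto
qed

lemma denom_sum_summable:
  assumes "1 < s"
  shows "(\<lambda>a. real (cf_denom a n) powr (- s)) summable_on ({1..n} \<rightarrow>\<^sub>E {1..})"
  using box_sum_bounded[OF assms, of n] denom_sum_le(1) by blast

lemma finite_sum_le_denom_sum:
  assumes "1 < s" "finite F" "F \<subseteq> {1..n} \<rightarrow>\<^sub>E {1..}"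
  shows "(\<Sum>a\<in>F. real (cf_denom a n) powr (- s)) \<le> denom_sum s n"
  unfolding denom_sum_def
  by (rule finite_sum_le_infsum[OF denom_sum_summable[OF assms(1)] assms(2,3)]) auto

lemma box_sum_le_denom_sum: "1 < s \<Longrightarrow> box_sum s n M \<le> denom_sum s n"
  unfolding box_sum_def by (intro finite_sum_le_denom_sum box_finite PiE_mono) auto

lemma denom_sum_add_le:
  assumes "1 < s"
  shows "denom_sum s (m + n) \<le> denom_sum s m * denom_sum s n"
proof (rule denom_sum_le(2))
  fix M
  have "box_sum s (m + n) M \<le> box_sum s m M * box_sum s n M"
    using assms by (intro box_sum_add_le) auto
  also have "\<dots> \<le> denom_sum s m * denom_sum s n"
    using assms box_sum_nonneg box_sum_le_denom_sum order_trans[OF box_sum_nonneg box_sum_le_denom_sum]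
    by (intro mult_mono) auto
  finally show "box_sum s (m + n) M \<le> denom_sum s m * denom_sum s n" .
qed

text \<open>The tuple of ones alone, with denominator at most \<open>2 ^ n\<close>, gives the bound.
  It makes the logarithms meaningful and the limit finite.\<close>

lemma denom_sum_ge:
  assumes "1 < s"
  shows "exp (- (real n * (s * ln 2))) \<le> denom_sum s n"
proof -
  define u where "u = restrict (\<lambda>_. 1::nat) {1..n}"
  have u: "cf_denom u n \<le> (1 + 1) ^ n" "1 \<le> cf_denom u n"
    using cf_denom_le_power[of n u 1] cf_denom_pos[of n u] by (auto simp: u_def)
  have "exp (- (real n * (s * ln 2))) = (2 ^ n) powr (- s)"
    by (simp add: powr_def ln_realpow)
  also have "\<dots> \<le> real (cf_denom u n) powr (- s)"
  proof (rule powr_mono2')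
    have "real (cf_denom u n) \<le> real ((1 + 1) ^ n)" using u(1) by (simp only: of_nat_le_iff)
    then show "real (cf_denom u n) \<le> 2 ^ n" by simp
  qed (use u assms in auto)
  also have "\<dots> = (\<Sum>a\<in>{u}. real (cf_denom a n) powr (- s))" by simp
  also have "\<dots> \<le> denom_sum s n"
    by (rule finite_sum_le_denom_sum[OF assms]) (auto simp: u_def)
  finally show ?thesis .
qed

lemma denom_sum_pos: "1 < s \<Longrightarrow> 0 < denom_sum s n"
  using denom_sum_ge[of s n] by (meson exp_gt_zero less_le_trans)

section \<open>The pressure as a limit, and its bound for some exponent above 1\<close>

text \<open>The limit is the infimum, finite by the linear lower bound. For a near-optimal
  \<open>m\<close>, division with remainder compares \<open>u n\<close> with \<open>n div m\<close>
  copies of \<open>u m\<close> plus a bounded term.\<close>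

lemma fekete:
  fixes u :: "nat \<Rightarrow> real"
  assumes sub: "\<And>m n. u (m + n) \<le> u m + u n" and bdd: "\<And>n. - (real n * C) \<le> u n"
  shows "convergent (\<lambda>n. u n / real n)"
proof -
  define L where "L = (INF n\<in>{1..}. u n / real n)"
  have below: "- C \<le> u n / real n" if "1 \<le> n" for n
    using bdd[of n] that by (simp add: field_simps)
  then have bb: "bdd_below ((\<lambda>n. u n / real n) ` {1..})" by (auto simp: bdd_below_def)
  have mult: "u (k * m + r) \<le> real k * u m + u r" for k m r
  proof (induction k)
    case (Suc k)
    show ?case using sub[of m "k * m + r"] Suc by (simp add: algebra_simps)
  qed simp
  have "(\<lambda>n. u n / real n) \<longlonglongrightarrow> L"
  proof (rule order_tendstoI)
    fix y assume "y < L"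
    moreover have "L \<le> u n / real n" if "n \<ge> 1" for n
      unfolding L_def by (rule cINF_lower[OF bb]) (use that in auto)
    ultimately show "\<forall>\<^sub>F n in sequentially. y < u n / real n"
      by (intro eventually_sequentiallyI[of 1]) (meson less_le_trans)
  next
    fix y assume "L < y"
    then obtain m where m: "m \<ge> 1" "u m / real m < y"
      unfolding L_def using cINF_less_iff[OF _ bb] by auto
    define R where "R = (\<Sum>r<m. \<bar>u r\<bar>)"
    have bound: "u n / real n \<le> u m / real m + (\<bar>u m\<bar> + R) / real n" if n: "n \<ge> 1" for n
    proof -
      define k where "k = n div m"
      define r where "r = n mod m"
      have n_eq: "n = k * m + r" and r: "r < m" using m by (auto simp: k_def r_def)
      have "u r \<le> R" unfolding R_def using r member_le_sum[of r "{..<m}" "\<lambda>r. \<bar>u r\<bar>"] by auto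
      \<comment> \<open>Replacing \<open>k\<close> by \<open>n / m\<close> costs less than one copy
        of \<open>u m\<close>, whose sign is unknown.\<close>
      moreover have "real k * u m \<le> real n * (u m / real m) + \<bar>u m\<bar>"
      proof -
        have "real k * u m = real n * (u m / real m) - (real r / real m) * u m"
          using m by (simp add: n_eq field_simps)
        moreover have "\<bar>(real r / real m) * u m\<bar> \<le> 1 * \<bar>u m\<bar>"
          unfolding abs_mult using r by (intro mult_right_mono) auto
        ultimately show ?thesis by linarith
      qed
      ultimately have "u n \<le> real n * (u m / real m) + (\<bar>u m\<bar> + R)"
        using mult[of k m r] n_eq by simp
      then have "u n / real n \<le> (real n * (u m / real m) + (\<bar>u m\<bar> + R)) / real n"
        by (rule divide_right_mono) simp
      then show ?thesis using n by (simp add: add_divide_distrib)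
    qed
    have "(\<lambda>n. u m / real m + (\<bar>u m\<bar> + R) / real n) \<longlonglongrightarrow> u m / real m + 0"
      by (intro tendsto_intros tendsto_divide_0[OF tendsto_const] filterlim_at_top_imp_at_infinity
          filterlim_real_sequentially)
    then have "\<forall>\<^sub>F n in sequentially. u m / real m + (\<bar>u m\<bar> + R) / real n < y"
      using m by (intro order_tendstoD(2)) auto
    then show "\<forall>\<^sub>F n in sequentially. u n / real n < y"
      using eventually_ge_at_top[of 1] by eventually_elim (use bound in force)
  qed
  then show ?thesis by (rule convergentI)
qed

lemma pressure_tendsto:
  assumes "1 / 2 < \<theta>"
  shows "(\<lambda>n. ln (denom_sum (2 * \<theta>) n) / real n) \<longlonglongrightarrow> pressure \<theta>"
proof -
  have s: "1 < 2 * \<theta>" using assms by simp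
  have "convergent (\<lambda>n. ln (denom_sum (2 * \<theta>) n) / real n)"
  proof (rule fekete)
    show "ln (denom_sum (2 * \<theta>) (m + n)) \<le> ln (denom_sum (2 * \<theta>) m) + ln (denom_sum (2 * \<theta>) n)" for m n
      using denom_sum_add_le[OF s, of m n] denom_sum_pos[OF s]
      by (simp add: ln_mult_pos[symmetric])
    show "- (real n * (2 * \<theta> * ln 2)) \<le> ln (denom_sum (2 * \<theta>) n)" for n
      using denom_sum_ge[OF s, of n] denom_sum_pos[OF s, of n] by (simp add: ln_ge_iff)
  qed
  then show ?thesis
    unfolding convergent_LIMSEQ_iff by (simp add: pressure_def denom_sum_def)
qed

text \<open>
  Appending a digit \<open>k\<close> turns \<open>q\<close> into \<open>q (k + x)\<close> and the ratio \<open>x\<close> of consecutive denominators into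
  \<open>1 / (k + x)\<close>, so summing over the last digit applies the transfer operator of exponent \<open>s\<close> to \<open>h\<close>.
\<close>

lemma weighted_box_sum_le:
  assumes h: "\<And>x. x \<in> {0..1} \<Longrightarrow> 0 \<le> h x"
    and L: "\<And>x. x \<in> {0..1} \<Longrightarrow> (\<Sum>k\<in>{1..M}. (real k + x) powr (- s) * h (1 / (real k + x))) \<le> \<rho> * h x"
    and \<rho>: "0 \<le> \<rho>"
  shows "(\<Sum>a\<in>{1..n} \<rightarrow>\<^sub>E {1..M}. real (cf_denom a n) powr (- s) * h (real (cf_prev a n) / real (cf_denom a n)))
    \<le> \<rho> ^ n * h 0"
proof (induction n)
  case (Suc n)
  define w where "w = (\<lambda>n a. real (cf_denom a n) powr (- s) * h (real (cf_prev a n) / real (cf_denom a n)))"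
  have "(\<Sum>k\<in>{1..M}. w (Suc n) (a(Suc n := k))) \<le> \<rho> * w n a" if a: "a \<in> {1..n} \<rightarrow>\<^sub>E {1..M}" for a
  proof -
    define q where "q = real (cf_denom a n)"
    define x where "x = real (cf_prev a n) / q"
    have q1: "1 \<le> cf_denom a n" "cf_prev a n \<le> cf_denom a n"
      using cf_denom_pos[of n a] a by (auto simp: PiE_iff)
    then have q: "1 \<le> q" and x: "x \<in> {0..1}" by (auto simp: q_def x_def divide_simps)
    have w: "w (Suc n) (a(Suc n := k)) = q powr (- s) * ((real k + x) powr (- s) * h (1 / (real k + x)))"
      if k: "k \<in> {1..M}" for k
    proof -
      have eq: "cf_denom (a(Suc n := k)) n = cf_denom a n \<and> cf_prev (a(Suc n := k)) n = cf_prev a n"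
        by (rule cf_denom_cong) auto
      then have "real (cf_denom (a(Suc n := k)) (Suc n)) = q * (real k + x)"
        using q by (simp add: cf_denom_Suc q_def x_def field_simps)
      then show ?thesis
        using eq q x k by (simp add: w_def powr_mult q_def)
    qed
    have "(\<Sum>k\<in>{1..M}. w (Suc n) (a(Suc n := k))) =
        q powr (- s) * (\<Sum>k\<in>{1..M}. (real k + x) powr (- s) * h (1 / (real k + x)))"
      unfolding sum_distrib_left by (rule sum.cong) (simp_all add: w)
    also have "\<dots> \<le> q powr (- s) * (\<rho> * h x)"
      by (intro mult_left_mono L x) auto
    finally show ?thesis by (simp add: w_def q_def x_def mult.left_commute)
  qed
  then have "(\<Sum>a\<in>{1..Suc n} \<rightarrow>\<^sub>E {1..M}. w (Suc n) a) \<le> \<rho> * (\<Sum>a\<in>{1..n} \<rightarrow>\<^sub>E {1..M}. w n a)"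
    unfolding sum_box_Suc sum_distrib_left by (rule sum_mono)
  also have "\<dots> \<le> \<rho> * (\<rho> ^ n * h 0)"
    using Suc \<rho> by (intro mult_left_mono) (auto simp: w_def)
  finally show ?case by (simp add: w_def)
qed simp

text \<open>Adding one digit multiplies the weighted sum by at most
  \<open>\<rho> = 1 - t * m\<close>, by the subsolution \<open>g\<close>. Hence the pressure is at
  most \<open>ln \<rho>\<close>, which is at most \<open>- (t * m)\<close>.\<close>

lemma pressure_le:
  assumes "m < levy_const"
  shows "\<exists>t>0. pressure (1 + t / 2) \<le> - (t * m)"
proof -
  from lyapunov_function[OF assms] obtain t g B where t: "0 < t" "0 < 1 - t * m"
    and g: "\<And>x. x \<in> {0..1} \<Longrightarrow> 1 \<le> g x \<and> g x \<le> B"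
    and U: "\<And>x. x \<in> {0..1} \<Longrightarrow> gauss_op (\<lambda>y. y powr t * g y) x \<le> (1 - t * m) * g x"
    by blast
  define \<rho> where "\<rho> = 1 - t * m"
  \<comment> \<open>The Gauss density undoes the normalisation of the weights, so that
    \<open>h\<close> suits the plain sum over digits.\<close>
  define h where "h = (\<lambda>x. g x / (1 + x))"
  have B: "1 \<le> B" using g[of 0] by auto
  have h0: "0 \<le> h x" if "x \<in> {0..1}" for x using g[OF that] that by (auto simp: h_def)
  have L: "(\<Sum>k\<in>{1..M}. (real k + x) powr (- (2 + t)) * h (1 / (real k + x))) \<le> \<rho> * h x"
    if x: "x \<in> {0..1}" for x M
  proof -
    define T where "T = (\<lambda>j. gauss_weight j x * (gauss_branch j x powr t * g (gauss_branch j x)))"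
    have bd: "\<bar>y powr t * g y\<bar> \<le> 1 * B" if "y \<in> {0..1}" for y
      unfolding abs_mult using g[OF that] that t powr_le1[of t y] by (intro mult_mono) auto
    have sm: "summable T"
      unfolding T_def using gauss_op_summable[of x "\<lambda>y. y powr t * g y" "1 * B", OF _ bd] x by simp
    have nn: "0 \<le> T j" for j
      unfolding T_def using x gauss_weight_nonneg[of x j] g[OF gauss_branch_mem'[of x j]] by simp
    \<comment> \<open>Index \<open>j\<close> of the operator belongs to the digit
      \<open>Suc j\<close>.\<close>
    have branch: "(real (Suc j) + x) powr (- (2 + t)) * h (1 / (real (Suc j) + x)) = T j / (1 + x)" for j
    proof -
      define z where "z = real (Suc j) + x"
      have z: "0 < z" using x by (simp add: z_def)
      have y: "gauss_branch j x = 1 / z" by (simp add: gauss_branch_def z_def add_ac)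
      have w: "gauss_weight j x = (1 + x) / (z * (z + 1))" by (simp add: gauss_weight_def z_def add_ac)
      have "z powr (- (2 + t)) = (1 / z) powr t / z\<^sup>2"
      proof -
        have "z powr (- (2 + t)) = z powr (- t) * z powr (- 2)"
          by (simp add: powr_add[symmetric] algebra_simps)
        also have "z powr (- 2) = 1 / z\<^sup>2" using z by (simp add: powr_minus_divide)
        also have "z powr (- t) = (1 / z) powr t" using z by (simp add: powr_minus_divide powr_divide)
        finally show ?thesis by simp
      qed
      then show ?thesis
        unfolding T_def y w h_def z_def[symmetric] using z x
        by (simp add: divide_simps power2_eq_square)
    qed
    have "(\<Sum>k\<in>{1..M}. (real k + x) powr (- (2 + t)) * h (1 / (real k + x))) = (\<Sum>j<M. T j / (1 + x))"
      using sum.atLeast1_atMost_eq[of "\<lambda>k. (real k + x) powr (- (2 + t)) * h (1 / (real k + x))" M]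
      by (simp only: branch One_nat_def)
    also have "\<dots> = (\<Sum>j<M. T j) / (1 + x)" by (simp add: sum_divide_distrib)
    also have "\<dots> \<le> suminf T / (1 + x)"
      using x by (intro divide_right_mono sum_le_suminf[OF sm]) (auto simp: nn)
    also have "\<dots> = gauss_op (\<lambda>y. y powr t * g y) x / (1 + x)" by (simp add: gauss_op_def T_def)
    also have "\<dots> \<le> \<rho> * g x / (1 + x)"
      using U[OF x] x by (intro divide_right_mono) (auto simp: \<rho>_def)
    finally show ?thesis by (simp add: h_def)
  qed
  \<comment> \<open>On the unit interval \<open>g x \<ge> 1\<close> and
    \<open>1 + x \<le> 2\<close>, so \<open>2 * h x \<ge> 1\<close>: the weight can be inserted at
    the cost of a factor 2, which disappears in the rate.\<close>
  have S: "denom_sum (2 + t) n \<le> 2 * B * \<rho> ^ n" for n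
  proof (rule denom_sum_le(2))
    fix M
    have "box_sum (2 + t) n M \<le> (\<Sum>a\<in>{1..n} \<rightarrow>\<^sub>E {1..M}.
        2 * (real (cf_denom a n) powr (- (2 + t)) * h (real (cf_prev a n) / real (cf_denom a n))))"
      unfolding box_sum_def
    proof (rule sum_mono)
      fix a assume a: "a \<in> {1..n} \<rightarrow>\<^sub>E {1..M}"
      define x where "x = real (cf_prev a n) / real (cf_denom a n)"
      have "1 \<le> cf_denom a n" "cf_prev a n \<le> cf_denom a n"
        using cf_denom_pos[of n a] a by (auto simp: PiE_iff)
      then have x: "x \<in> {0..1}" by (auto simp: x_def divide_simps)
      then have "1 \<le> 2 * h x" using g[OF x] by (simp add: h_def field_simps)
      then have "real (cf_denom a n) powr (- (2 + t)) * 1 \<le> real (cf_denom a n) powr (- (2 + t)) * (2 * h x)"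
        by (intro mult_left_mono) auto
      then show "real (cf_denom a n) powr (- (2 + t)) \<le>
          2 * (real (cf_denom a n) powr (- (2 + t)) * h (real (cf_prev a n) / real (cf_denom a n)))"
        by (simp add: x_def)
    qed
    also have "\<dots> \<le> 2 * (\<rho> ^ n * h 0)"
      unfolding sum_distrib_left[symmetric]
      using weighted_box_sum_le[where M = M and n = n, OF h0 L] t by (intro mult_left_mono) (auto simp: \<rho>_def)
    also have "\<dots> \<le> 2 * (\<rho> ^ n * B)"
      using g[of 0] t by (intro mult_left_mono) (auto simp: h_def \<rho>_def)
    finally show "box_sum (2 + t) n M \<le> 2 * B * \<rho> ^ n" by (simp add: mult_ac)
  qed
  have "pressure (1 + t / 2) \<le> ln \<rho>"
  proof (rule LIMSEQ_le)
    show "(\<lambda>n. ln (denom_sum (2 + t) n) / real n) \<longlonglongrightarrow> pressure (1 + t / 2)"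
      using pressure_tendsto[of "1 + t / 2"] t by (simp add: algebra_simps)
    have "(\<lambda>n. ln (2 * B) / real n + ln \<rho>) \<longlonglongrightarrow> 0 + ln \<rho>"
      by (intro tendsto_intros tendsto_divide_0[OF tendsto_const] filterlim_at_top_imp_at_infinity
          filterlim_real_sequentially)
    then show "(\<lambda>n. ln (2 * B) / real n + ln \<rho>) \<longlonglongrightarrow> ln \<rho>" by simp
    have "ln (denom_sum (2 + t) n) / real n \<le> ln (2 * B) / real n + ln \<rho>" if n: "n \<ge> 1" for n
    proof -
      have "ln (denom_sum (2 + t) n) \<le> ln (2 * B * \<rho> ^ n)"
        using S[of n] denom_sum_pos[of "2 + t" n] t by simp
      also have "\<dots> = ln (2 * B) + real n * ln \<rho>"
        using B t by (simp add: ln_mult_pos ln_realpow \<rho>_def)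
      finally show ?thesis using n by (simp add: field_simps)
    qed
    then show "\<exists>N. \<forall>n\<ge>N. ln (denom_sum (2 + t) n) / real n \<le> ln (2 * B) / real n + ln \<rho>" by blast
  qed
  also have "\<dots> \<le> - (t * m)" using ln_le_minus_one[of \<rho>] t by (simp add: \<rho>_def)
  finally show ?thesis using t by blast
qed

text \<open>With \<open>m = levy_const - \<epsilon> / 2\<close> the pressure bound beats the linear
  term by \<open>t * \<epsilon> / 2\<close>.\<close>

lemma theta2_neg:
  assumes "0 < \<epsilon>"
  shows "theta2 \<epsilon> < 0"
proof -
  obtain t where t: "0 < t" "pressure (1 + t / 2) \<le> - (t * (levy_const - \<epsilon> / 2))"
    using pressure_le[of "levy_const - \<epsilon> / 2"] assms by auto
  have "theta2 \<epsilon> \<le> ereal (t * (levy_const - \<epsilon>) + pressure (1 + t / 2))"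
    unfolding theta2_def by (rule INF_lower) (use t in auto)
  also have "\<dots> < 0"
  proof -
    have "0 < t * \<epsilon>" using t assms by simp
    then show ?thesis using t(2) by (simp add: algebra_simps)
  qed
  finally show ?thesis by simp
qed

subsection \<open>Cylinders and the slow set\<close>

text \<open>Numerators of convergents with no integer part. The second equation is the general
  recursion with value 1 at index -1, which \<open>cf_numer_prev\<close> supplies.\<close>

fun cf_numer :: "(nat \<Rightarrow> nat) \<Rightarrow> nat \<Rightarrow> nat" where
  "cf_numer a 0 = 0"
| "cf_numer a (Suc 0) = 1"
| "cf_numer a (Suc (Suc n)) = a (Suc (Suc n)) * cf_numer a (Suc n) + cf_numer a n"

definition cf_numer_prev :: "(nat \<Rightarrow> nat) \<Rightarrow> nat \<Rightarrow> nat" where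
  "cf_numer_prev a n = (case n of 0 \<Rightarrow> 1 | Suc m \<Rightarrow> cf_numer a m)"

lemma cf_numer_prev_simps [simp]: "cf_numer_prev a 0 = 1" "cf_numer_prev a (Suc n) = cf_numer a n"
  by (simp_all add: cf_numer_prev_def)

lemma cf_numer_Suc: "cf_numer a (Suc n) = a (Suc n) * cf_numer a n + cf_numer_prev a n"
  by (cases n) auto

declare cf_numer.simps(2,3) [simp del]

lemma cf_numer_cong:
  assumes "\<And>i. i \<in> {1..n} \<Longrightarrow> a i = b i"
  shows "cf_numer a n = cf_numer b n \<and> cf_numer_prev a n = cf_numer_prev b n"
  using assms by (induction n) (auto simp: cf_numer_Suc)

text \<open>For fixed length this leaves only finitely many tuples with denominator below a given
  bound.\<close>

lemma digit_le_cf_denom: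
  assumes "\<And>i. i \<in> {1..n} \<Longrightarrow> 1 \<le> a i" "i \<in> {1..n}"
  shows "a i \<le> cf_denom a n"
  using assms
proof (induction n)
  case (Suc n)
  have pos: "1 \<le> cf_denom a n" using cf_denom_pos[of n a] Suc.prems(1) by auto
  show ?case
  proof (cases "i = Suc n")
    case True
    have "a (Suc n) * 1 \<le> a (Suc n) * cf_denom a n" using pos by (intro mult_left_mono) auto
    then show ?thesis unfolding True cf_denom_Suc by linarith
  next
    case False
    then have "a i \<le> cf_denom a n" using Suc by auto
    also have "\<dots> \<le> cf_denom a (Suc n)"
      using cf_denom_pos[of "Suc n" a] Suc.prems(1) by auto
    finally show ?thesis .
  qed
qed simp

lemma cf_determinant:
  "real (cf_numer_prev a n) * real (cf_denom a n) - real (cf_numer a n) * real (cf_prev a n) = (- 1) ^ n"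
proof (induction n)
  case (Suc n)
  then show ?case by (simp add: cf_denom_Suc cf_numer_Suc algebra_simps)
qed simp

text \<open>For positive digits this is the continued fraction whose last digit is increased by
  \<open>y\<close>: the inverse branch of the \<open>n\<close>-th iterate of the Gauss map. For
  \<open>n = 0\<close> it is the identity.\<close>

definition cf_moebius :: "(nat \<Rightarrow> nat) \<Rightarrow> nat \<Rightarrow> real \<Rightarrow> real" where
  "cf_moebius a n y = (real (cf_numer a n) + real (cf_numer_prev a n) * y) /
     (real (cf_denom a n) + real (cf_prev a n) * y)"

lemma cf_moebius_Suc:
  assumes "0 < real (a (Suc n)) + y"
  shows "cf_moebius a (Suc n) y = cf_moebius a n (1 / (real (a (Suc n)) + y))"
proof -
  define z where "z = real (a (Suc n)) + y"
  have z: "0 < z" using assms by (simp add: z_def)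
  have frac: "A + B * (1 / z) = (A * z + B) / z" for A B using z by (simp add: field_simps)
  have "real (cf_numer a (Suc n)) + real (cf_numer_prev a (Suc n)) * y =
      real (cf_numer a n) * z + real (cf_numer_prev a n)"
    "real (cf_denom a (Suc n)) + real (cf_prev a (Suc n)) * y =
      real (cf_denom a n) * z + real (cf_prev a n)"
    by (simp_all add: cf_denom_Suc cf_numer_Suc z_def algebra_simps)
  then show ?thesis
    unfolding cf_moebius_def z_def[symmetric] frac using z by simp
qed

section \<open>Digits of irrational numbers and the cylinder of a tuple\<close>

lemma irrational_inverse: "x \<notin> \<rat> \<Longrightarrow> 1 / x \<notin> \<rat>" for x :: real
  using Rats_inverse[of "1 / x"] by (auto simp: inverse_eq_divide)

lemma gauss_map_irrational:
  fixes x :: real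
  assumes "x \<in> {0<..<1} - \<rat>"
  shows "gauss_map x \<in> {0<..<1} - \<rat>"
proof -
  have x: "0 < x" "x < 1" "x \<notin> \<rat>" using assms by auto
  have g: "gauss_map x = 1 / x - of_int \<lfloor>1 / x\<rfloor>" using x by (simp add: gauss_map_def)
  have irr: "gauss_map x \<notin> \<rat>"
  proof
    assume "gauss_map x \<in> \<rat>"
    then have "gauss_map x + of_int \<lfloor>1 / x\<rfloor> \<in> \<rat>" by (intro Rats_add Rats_of_int)
    then show False using irrational_inverse[OF x(3)] by (simp add: g)
  qed
  then have "gauss_map x \<noteq> 0" by auto
  moreover have "0 \<le> gauss_map x" "gauss_map x < 1" unfolding g by linarith+
  ultimately show ?thesis using irr by auto
qed

lemma gauss_map_iterate_irrational:
  "x \<in> {0<..<1} - \<rat> \<Longrightarrow> (gauss_map ^^ n) x \<in> {0<..<1} - \<rat>"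
proof (induction n)
  case (Suc n)
  then show ?case using gauss_map_irrational[of "(gauss_map ^^ n) x"] by simp
qed simp

lemma cf_digit_Suc: "cf_digit x (Suc n) = nat \<lfloor>1 / (gauss_map ^^ n) x\<rfloor>"
  by (simp add: cf_digit_def)

lemma cf_digit_step:
  assumes "x \<in> {0<..<1} - \<rat>"
  shows "1 \<le> cf_digit x (Suc n)"
    and "(gauss_map ^^ n) x = 1 / (real (cf_digit x (Suc n)) + (gauss_map ^^ Suc n) x)"
proof -
  define y where "y = (gauss_map ^^ n) x"
  have y: "0 < y" "y < 1" using gauss_map_iterate_irrational[OF assms, of n] by (auto simp: y_def)
  then have "1 \<le> 1 / y" by simp
  then have f: "1 \<le> \<lfloor>1 / y\<rfloor>" by (simp only: one_le_floor)
  then show "1 \<le> cf_digit x (Suc n)" unfolding cf_digit_Suc y_def[symmetric] by linarith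
  have "real (cf_digit x (Suc n)) = of_int \<lfloor>1 / y\<rfloor>"
    unfolding cf_digit_Suc y_def[symmetric] by (rule of_nat_nat) (use f in linarith)
  moreover have "(gauss_map ^^ Suc n) x = 1 / y - of_int \<lfloor>1 / y\<rfloor>"
    using y by (simp add: y_def[symmetric] gauss_map_def)
  ultimately show "(gauss_map ^^ n) x = 1 / (real (cf_digit x (Suc n)) + (gauss_map ^^ Suc n) x)"
    using y by (simp add: y_def[symmetric])
qed

lemma cf_digit_pos: "x \<in> {0<..<1} - \<rat> \<Longrightarrow> 1 \<le> i \<Longrightarrow> 1 \<le> cf_digit x i"
  using cf_digit_step(1)[of x "i - 1"] by simp

lemma cf_expansion:
  assumes "x \<in> {0<..<1} - \<rat>"
  shows "x = cf_moebius (cf_digit x) n ((gauss_map ^^ n) x)"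
proof (induction n)
  case 0 show ?case by (simp add: cf_moebius_def)
next
  case (Suc n)
  have "0 < real (cf_digit x (Suc n)) + (gauss_map ^^ Suc n) x"
    using cf_digit_step(1)[OF assms, of n] gauss_map_iterate_irrational[OF assms, of "Suc n"]
    by (auto intro: add_pos_pos simp del: funpow.simps)
  from cf_moebius_Suc[of "cf_digit x" n, OF this]
  have "cf_moebius (cf_digit x) (Suc n) ((gauss_map ^^ Suc n) x) =
      cf_moebius (cf_digit x) n ((gauss_map ^^ n) x)"
    unfolding cf_digit_step(2)[OF assms, of n] .
  then show ?case by (rule trans[OF Suc sym])
qed

lemma gauss_map_branch:
  assumes "1 \<le> k" "y \<in> {0<..<1} - \<rat>"
  shows "1 / (real k + y) \<in> {0<..<1} - \<rat>"
    and "nat \<lfloor>1 / (1 / (real k + y))\<rfloor> = k"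
    and "gauss_map (1 / (real k + y)) = y"
proof -
  have y: "0 < y" "y < 1" "y \<notin> \<rat>" using assms by auto
  have "real k + y \<notin> \<rat>"
  proof
    assume "real k + y \<in> \<rat>"
    then have "real k + y - real k \<in> \<rat>" by (intro Rats_diff Rats_of_nat)
    then show False using y by simp
  qed
  then show "1 / (real k + y) \<in> {0<..<1} - \<rat>"
    using irrational_inverse y assms(1) by auto
  have fl: "\<lfloor>real k + y\<rfloor> = int k" using y by (intro floor_unique) auto
  then show "nat \<lfloor>1 / (1 / (real k + y))\<rfloor> = k" by simp
  show "gauss_map (1 / (real k + y)) = y" using fl y by (simp add: gauss_map_def)
qed

text \<open>Converse of \<open>cf_expansion\<close>. The last digit is peeled off, which changes the
  argument; hence the induction is over all \<open>y\<close>.\<close>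

lemma cf_moebius_digits:
  assumes "\<And>i. i \<in> {1..n} \<Longrightarrow> 1 \<le> a i" "y \<in> {0<..<1} - \<rat>"
  shows "cf_moebius a n y \<in> {0<..<1} - \<rat> \<and> (gauss_map ^^ n) (cf_moebius a n y) = y \<and>
    (\<forall>i\<in>{1..n}. cf_digit (cf_moebius a n y) i = a i)"
  using assms
proof (induction n arbitrary: y)
  case 0 then show ?case by (simp add: cf_moebius_def)
next
  case (Suc n)
  define k where "k = a (Suc n)"
  define z where "z = 1 / (real k + y)"
  have k: "1 \<le> k" using Suc.prems by (simp add: k_def)
  have m: "cf_moebius a (Suc n) y = cf_moebius a n z"
    unfolding z_def k_def using Suc.prems by (intro cf_moebius_Suc) auto
  have z: "z \<in> {0<..<1} - \<rat>" "nat \<lfloor>1 / z\<rfloor> = k" "gauss_map z = y"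
    unfolding z_def using gauss_map_branch[OF k Suc.prems(2)] by blast+
  have IH: "cf_moebius a n z \<in> {0<..<1} - \<rat>" "(gauss_map ^^ n) (cf_moebius a n z) = z"
    "\<And>i. i \<in> {1..n} \<Longrightarrow> cf_digit (cf_moebius a n z) i = a i"
    using Suc.IH[OF _ z(1)] Suc.prems(1) by auto
  have "cf_digit (cf_moebius a n z) i = a i" if i: "i \<in> {1..Suc n}" for i
  proof (cases "i = Suc n")
    case True then show ?thesis using IH(2) z(2) by (simp add: cf_digit_Suc k_def)
  next
    case False then show ?thesis using IH(3) i by auto
  qed
  then show ?case unfolding m using IH z(3) by simp
qed

text \<open>Over a common denominator the numerator is the determinant \<open>(- 1) ^ n\<close>; the
  absolute value removes the alternating orientation.\<close>

lemma cf_moebius_endpoints: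
  assumes "\<And>i. i \<in> {1..n} \<Longrightarrow> 1 \<le> a i"
  shows "\<bar>cf_moebius a n 1 - cf_moebius a n 0\<bar> =
    1 / (real (cf_denom a n) * (real (cf_denom a n) + real (cf_prev a n)))"
proof -
  define q where "q = real (cf_denom a n)"
  define q' where "q' = real (cf_prev a n)"
  have q: "0 < q" "0 \<le> q'" using cf_denom_pos[of n a] assms by (auto simp: q_def q'_def)
  have "cf_moebius a n 1 - cf_moebius a n 0 =
      (real (cf_numer_prev a n) * q - real (cf_numer a n) * q') / (q * (q + q'))"
    unfolding cf_moebius_def q_def[symmetric] q'_def[symmetric] using q by (simp add: field_simps)
  also have "\<dots> = (- 1) ^ n / (q * (q + q'))" using cf_determinant[of a n] by (simp add: q_def q'_def)
  finally show ?thesis using q by (simp add: abs_mult q_def q'_def power_abs)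
qed

text \<open>The splitting \<open>p + p' * y = (1 - y) * p + y * (p + p')\<close> exhibits the value
  as a convex combination of the end values, with weight \<open>u\<close> at the right end.\<close>

lemma cf_moebius_in_segment:
  assumes "\<And>i. i \<in> {1..n} \<Longrightarrow> 1 \<le> a i" "y \<in> {0..1}"
  shows "cf_moebius a n y \<in> closed_segment (cf_moebius a n 0) (cf_moebius a n 1)"
proof -
  define q where "q = real (cf_denom a n)"
  define q' where "q' = real (cf_prev a n)"
  have q: "0 < q" "0 \<le> q'" using cf_denom_pos[of n a] assms by (auto simp: q_def q'_def)
  have d: "0 < q + q'" "0 < q + q' * y" using q assms(2) by (auto intro: add_pos_nonneg)
  define u where "u = y * (q + q') / (q + q' * y)"
  have "y * q \<le> q" using assms(2) q by (simp add: mult_left_le_one_le)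
  then have u: "0 \<le> u" "u \<le> 1" using d q assms(2) by (auto simp: u_def field_simps)
  have u': "1 - u = q * (1 - y) / (q + q' * y)" using d by (simp add: u_def field_simps)
  define p where "p = real (cf_numer a n)"
  define p' where "p' = real (cf_numer_prev a n)"
  have "(1 - u) * cf_moebius a n 0 = (1 - y) * p / (q + q' * y)"
    unfolding u' using q by (simp add: cf_moebius_def q_def p_def)
  moreover have "u * cf_moebius a n 1 = y * (p + p') / (q + q' * y)"
    using d by (simp add: u_def cf_moebius_def q_def[symmetric] q'_def[symmetric] p_def p'_def)
  moreover have "cf_moebius a n y = (p + p' * y) / (q + q' * y)"
    by (simp add: cf_moebius_def q_def q'_def p_def p'_def)
  moreover have "p + p' * y = (1 - y) * p + y * (p + p')" by (simp add: algebra_simps)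
  ultimately have "cf_moebius a n y = (1 - u) * cf_moebius a n 0 + u * cf_moebius a n 1"
    by (simp only: add_divide_distrib)
  then show ?thesis unfolding closed_segment_def using u by auto
qed

text \<open>By connectedness every point of the segment is a value of the map at some
  \<open>y\<close> in the unit interval. A rational \<open>y\<close> would give a rational point, so
  \<open>y\<close> is irrational and, in particular, not an end point.\<close>

lemma open_segment_in_cylinder:
  assumes a: "\<And>i. i \<in> {1..n} \<Longrightarrow> 1 \<le> a i"
    and x: "x \<in> open_segment (cf_moebius a n 0) (cf_moebius a n 1)" "x \<notin> \<rat>"
  shows "x \<in> {0<..<1} - \<rat> \<and> (\<forall>i\<in>{1..n}. cf_digit x i = a i)"
proof -
  have q: "0 < real (cf_denom a n)" using cf_denom_pos[of n a] a by auto
  have "continuous_on {0..1} (cf_moebius a n)"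
    unfolding cf_moebius_def
    using q by (intro continuous_intros) (auto simp: add_pos_nonneg less_imp_neq[THEN not_sym])
  then have "connected (cf_moebius a n ` {0..1})"
    by (rule connected_continuous_image) simp
  then have "closed_segment (cf_moebius a n 0) (cf_moebius a n 1) \<subseteq> cf_moebius a n ` {0..1}"
    using is_interval_connected_1 is_interval_convex_1 by (intro closed_segment_subset) auto
  then obtain y where y: "y \<in> {0..1}" "x = cf_moebius a n y"
    using x(1) by (auto simp: open_segment_def)
  have "y \<notin> \<rat>"
  proof
    assume "y \<in> \<rat>"
    then have "x \<in> \<rat>" unfolding y(2) cf_moebius_def
      by (intro Rats_divide Rats_add Rats_mult Rats_of_nat)
    then show False using x(2) by simp
  qed
  then have "y \<in> {0<..<1} - \<rat>" using y(1) by (cases "y = 0 \<or> y = 1") auto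
  from cf_moebius_digits[of n a, OF a this] show ?thesis using y(2) by auto
qed

section \<open>Measurability of the digits and of the slow set\<close>

lemma measure_segment: "measure lebesgue (closed_segment x y) = \<bar>y - x\<bar>" for x y :: real
  by (simp add: closed_segment_eq_real_ivl)

lemma gauss_map_measurable [measurable]: "gauss_map \<in> borel_measurable borel"
  unfolding gauss_map_def[abs_def] by measurable

lemma gauss_map_iterate_measurable [measurable]: "(gauss_map ^^ n) \<in> borel_measurable borel"
proof (induction n)
  case (Suc n)
  then have "(\<lambda>x. gauss_map ((gauss_map ^^ n) x)) \<in> borel_measurable borel" by measurable
  then show ?case by (simp add: o_def)
qed simp

lemma cf_digit_measurable: "(\<lambda>x. cf_digit x i) \<in> measurable borel (count_space UNIV)"
proof -
  have "(\<lambda>x. \<lfloor>1 / (gauss_map ^^ (i - 1)) x\<rfloor>) \<in> measurable borel (count_space UNIV)" by measurable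
  then show ?thesis unfolding cf_digit_def by measurable
qed

lemma cf_q_measurable: "(\<lambda>x. real (cf_q n x)) \<in> borel_measurable borel"
proof -
  have d: "(\<lambda>x. real (cf_digit x i)) \<in> borel_measurable borel" for i
    using cf_digit_measurable[of i] by measurable
  have "(\<lambda>x. real (cf_denom (cf_digit x) n)) \<in> borel_measurable borel \<and>
    (\<lambda>x. real (cf_prev (cf_digit x) n)) \<in> borel_measurable borel"
    using d by (induction n) (auto simp: cf_denom_Suc)
  then show ?thesis by (simp add: cf_q_def)
qed

lemma rats_borel: "(\<rat> :: real set) \<in> sets borel"
  by (rule sets.countable[OF borel_singleton[OF sets.empty_sets] countable_rat])

lemma slow_set_borel: "slow_set \<epsilon> n \<in> sets borel"
proof -
  have "(\<lambda>x. ln (real (cf_q n x)) / real n) \<in> borel_measurable borel"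
    by (intro borel_measurable_divide borel_measurable_ln cf_q_measurable borel_measurable_const)
  then have meas: "{x \<in> space borel. ln (real (cf_q n x)) / real n \<le> levy_const - \<epsilon>} \<in> sets borel"
    unfolding borel_measurable_iff_le by blast
  have eq: "slow_set \<epsilon> n = ({0..<1} - \<rat>) \<inter>
      {x \<in> space borel. ln (real (cf_q n x)) / real n \<le> levy_const - \<epsilon>}"
    by (auto simp: slow_set_def)
  show ?thesis
    unfolding eq by (intro sets.Int sets.Diff rats_borel atLeastLessThan_borel meas)
qed

lemma slow_set_lmeasurable: "slow_set \<epsilon> n \<in> lmeasurable"
proof (rule bounded_set_imp_lmeasurable)
  show "bounded (slow_set \<epsilon> n)" by (rule bounded_subset[of "{0..1}"]) (auto simp: slow_set_def)
  show "slow_set \<epsilon> n \<in> sets lebesgue" using slow_set_borel by auto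
qed

text \<open>Denominators are at least 1, so the logarithm can be removed; 0 is rational, so the
  interval becomes open.\<close>

lemma slow_set_iff:
  assumes "1 \<le> n"
  shows "x \<in> slow_set \<epsilon> n \<longleftrightarrow> x \<in> {0<..<1} - \<rat> \<and> real (cf_q n x) \<le> exp (real n * (levy_const - \<epsilon>))"
proof (cases "x \<in> {0<..<1} - \<rat>")
  case True
  then have "1 \<le> cf_q n x"
    unfolding cf_q_def using cf_denom_pos[of n "cf_digit x"] cf_digit_pos by auto
  then have ln_le: "ln (real (cf_q n x)) \<le> r \<longleftrightarrow> real (cf_q n x) \<le> exp r" for r
    using ln_le_cancel_iff[of "real (cf_q n x)" "exp r"] by simp
  have "ln (real (cf_q n x)) / real n \<le> levy_const - \<epsilon> \<longleftrightarrow>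
      ln (real (cf_q n x)) \<le> (levy_const - \<epsilon>) * real n"
    by (rule pos_divide_le_eq) (use assms in simp)
  also have "\<dots> \<longleftrightarrow> real (cf_q n x) \<le> exp (real n * (levy_const - \<epsilon>))"
    unfolding ln_le by (simp only: mult.commute)
  finally show ?thesis using True unfolding slow_set_def by auto
next
  case False
  then have "x \<notin> {0..<1} - \<rat>" by (cases "x = 0") auto
  then have "x \<notin> slow_set \<epsilon> n" unfolding slow_set_def by blast
  then show ?thesis using False by blast
qed

section \<open>The upper bound by covering with cylinders\<close>

lemma measure_slow_set_le:
  assumes n: "1 \<le> n" and t: "0 < t"
  shows "measure lebesgue (slow_set \<epsilon> n) \<le>
    exp (real n * t * (levy_const - \<epsilon>)) * denom_sum (2 + t) n"
proof -
  define Q where "Q = exp (real n * (levy_const - \<epsilon>))"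
  \<comment> \<open>Digits do not exceed the denominator, hence not \<open>Q\<close>; this makes the
    cover finite.\<close>
  define M where "M = nat \<lfloor>Q\<rfloor>"
  define F where "F = {a \<in> {1..n} \<rightarrow>\<^sub>E {1..M}. real (cf_denom a n) \<le> Q}"
  define I where "I = (\<lambda>a. closed_segment (cf_moebius a n 0) (cf_moebius a n 1))"
  have Q: "0 < Q" by (simp add: Q_def)
  have F: "finite F" unfolding F_def using box_finite by auto
  have cover: "slow_set \<epsilon> n \<subseteq> (\<Union>a\<in>F. I a)"
  proof
    fix x assume "x \<in> slow_set \<epsilon> n"
    then have x: "x \<in> {0<..<1} - \<rat>" "real (cf_q n x) \<le> Q"
      using slow_set_iff[OF n] by (auto simp: Q_def)
    define a where "a = restrict (cf_digit x) {1..n}"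
    have eq: "cf_denom a n = cf_q n x"
      unfolding cf_q_def by (rule conjunct1[OF cf_denom_cong]) (simp add: a_def)
    have moeb: "cf_moebius a n = cf_moebius (cf_digit x) n"
    proof -
      have "cf_numer a n = cf_numer (cf_digit x) n \<and> cf_numer_prev a n = cf_numer_prev (cf_digit x) n"
        by (rule cf_numer_cong) (simp add: a_def)
      moreover have "cf_denom a n = cf_denom (cf_digit x) n \<and> cf_prev a n = cf_prev (cf_digit x) n"
        by (rule cf_denom_cong) (simp add: a_def)
      ultimately show ?thesis by (intro ext) (simp add: cf_moebius_def)
    qed
    have pos: "1 \<le> a i" if "i \<in> {1..n}" for i using cf_digit_pos[OF x(1)] that by (simp add: a_def)
    have "a i \<le> M" if "i \<in> {1..n}" for i
    proof -
      have "a i \<le> cf_denom a n" by (rule digit_le_cf_denom[OF pos that])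
      then have "real (a i) \<le> Q" using x(2) eq by linarith
      then show ?thesis unfolding M_def by (simp add: le_nat_floor)
    qed
    then have "a \<in> {1..n} \<rightarrow>\<^sub>E {1..M}" using pos by (simp add: a_def restrict_PiE_iff)
    then have "a \<in> F" using x(2) eq by (simp add: F_def)
    moreover have "x \<in> I a"
    proof -
      have "(gauss_map ^^ n) x \<in> {0..1}" using gauss_map_iterate_irrational[OF x(1), of n] by auto
      from cf_moebius_in_segment[of n a, OF pos this]
      have "cf_moebius a n ((gauss_map ^^ n) x) \<in> I a" unfolding I_def .
      moreover have "cf_moebius a n ((gauss_map ^^ n) x) = x"
        unfolding moeb by (rule cf_expansion[OF x(1), symmetric])
      ultimately show ?thesis by simp
    qed
    ultimately show "x \<in> (\<Union>a\<in>F. I a)" by blast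
  qed
  have I: "I a \<in> lmeasurable" for a unfolding I_def by (simp add: closed_segment_eq_real_ivl)
  have "measure lebesgue (slow_set \<epsilon> n) \<le> measure lebesgue (\<Union>a\<in>F. I a)"
    by (rule measure_mono_fmeasurable[OF cover]) (use slow_set_lmeasurable F I in auto)
  also have "\<dots> \<le> (\<Sum>a\<in>F. measure lebesgue (I a))"
    by (rule measure_UNION_le[OF F]) (use I in auto)
  also have "\<dots> \<le> (\<Sum>a\<in>F. Q powr t * real (cf_denom a n) powr (- (2 + t)))"
  proof (rule sum_mono)
    fix a assume a: "a \<in> F"
    then have pos: "1 \<le> a i" if "i \<in> {1..n}" for i
      using that by (auto simp: F_def PiE_iff)
    define q where "q = real (cf_denom a n)"
    have q: "1 \<le> q" "q \<le> Q" using cf_denom_pos[of n a] pos a by (auto simp: q_def F_def)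
    have "measure lebesgue (I a) = 1 / (q * (q + real (cf_prev a n)))"
      unfolding I_def measure_segment q_def by (rule cf_moebius_endpoints[OF pos])
    also have "\<dots> \<le> 1 / (q * q)"
      using q by (intro divide_left_mono mult_left_mono) auto
    also have "\<dots> = q powr (- 2)" using q by (simp add: powr_minus_divide power2_eq_square)
    \<comment> \<open>The Chernoff step: the factor \<open>q powr t\<close> is split off and then
      enlarged to \<open>Q powr t\<close>.\<close>
    also have "\<dots> = q powr t * q powr (- (2 + t))" using q by (simp add: powr_add[symmetric])
    also have "\<dots> \<le> Q powr t * q powr (- (2 + t))"
      using q t by (intro mult_right_mono powr_mono2) auto
    finally show "measure lebesgue (I a) \<le> Q powr t * real (cf_denom a n) powr (- (2 + t))"
      by (simp add: q_def)
  qed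
  also have "\<dots> = Q powr t * (\<Sum>a\<in>F. real (cf_denom a n) powr (- (2 + t)))"
    by (simp add: sum_distrib_left)
  also have "\<dots> \<le> Q powr t * denom_sum (2 + t) n"
  proof (intro mult_left_mono finite_sum_le_denom_sum F)
    show "F \<subseteq> {1..n} \<rightarrow>\<^sub>E {1..}" using PiE_mono[of "{1..n}" "\<lambda>_. {1..M}" "\<lambda>_. {1..}"] by (auto simp: F_def)
  qed (use t in auto)
  also have "Q powr t = exp (real n * t * (levy_const - \<epsilon>))"
    using Q by (simp add: powr_def Q_def mult_ac)
  finally show ?thesis .
qed

lemma elog_mono: "0 \<le> x \<Longrightarrow> x \<le> y \<Longrightarrow> elog x \<le> elog y"
  by (auto simp: elog_def)

lemma limsup_log_rate_le:
  assumes t: "0 < t"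
  shows "limsup (log_rate \<epsilon>) \<le> ereal (t * (levy_const - \<epsilon>) + pressure (1 + t / 2))"
proof -
  define r where "r = (\<lambda>n. t * (levy_const - \<epsilon>) + ln (denom_sum (2 + t) n) / real n)"
  have "log_rate \<epsilon> n \<le> ereal (r n)" if n: "1 \<le> n" for n
  proof -
    define X where "X = exp (real n * t * (levy_const - \<epsilon>)) * denom_sum (2 + t) n"
    have pos: "0 < denom_sum (2 + t) n" using t by (intro denom_sum_pos) auto
    then have X: "0 < X" by (simp add: X_def)
    have "log_rate \<epsilon> n \<le> ereal (1 / real n) * elog X"
      unfolding log_rate_def
      using measure_slow_set_le[OF n t, of \<epsilon>] by (intro ereal_mult_left_mono elog_mono) (auto simp: X_def)
    also have "\<dots> = ereal (ln X / real n)" using X by (simp add: elog_def)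
    also have "ln X / real n = r n"
      using pos n by (simp add: X_def r_def ln_mult_pos add_divide_distrib)
    finally show ?thesis .
  qed
  then have "limsup (log_rate \<epsilon>) \<le> limsup (\<lambda>n. ereal (r n))"
    by (intro Limsup_mono eventually_sequentiallyI[of 1]) auto
  also have "r \<longlonglongrightarrow> t * (levy_const - \<epsilon>) + pressure (1 + t / 2)"
    unfolding r_def using pressure_tendsto[of "1 + t / 2"] t
    by (intro tendsto_intros) (simp add: algebra_simps)
  then have "limsup (\<lambda>n. ereal (r n)) = ereal (t * (levy_const - \<epsilon>) + pressure (1 + t / 2))"
    by (intro lim_imp_Limsup) auto
  finally show ?thesis .
qed

section \<open>The lower bound from a constant digit\<close>

text \<open>For \<open>s = sqrt 3 * m\<close> one has \<open>m * s + 1 \<le> s^2\<close>, so powers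
  of \<open>s\<close> dominate the recursion with constant digit \<open>m\<close>. The square of
  \<open>s\<close> is the source of \<open>ln 3\<close> in the final bound.\<close>

lemma cf_denom_const_le:
  assumes m: "1 \<le> m"
  shows "real (cf_denom (\<lambda>_. m) n) \<le> (sqrt 3 * real m) ^ n \<and>
    sqrt 3 * real m * real (cf_prev (\<lambda>_. m) n) \<le> (sqrt 3 * real m) ^ n"
proof (induction n)
  case (Suc n)
  define s where "s = sqrt 3 * real m"
  have s: "0 < s" using m by (simp add: s_def)
  have key: "real m * s + 1 \<le> s\<^sup>2"
  proof -
    have "sqrt 3 \<le> sqrt 4" by (rule real_sqrt_le_mono) simp
    then have "sqrt 3 * (real m)\<^sup>2 \<le> 2 * (real m)\<^sup>2" by (intro mult_right_mono) auto
    moreover have "1 \<le> (real m)\<^sup>2" using m by (simp add: one_le_power)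
    moreover have "real m * s = sqrt 3 * (real m)\<^sup>2" "s\<^sup>2 = 3 * (real m)\<^sup>2"
      by (simp_all add: s_def power_mult_distrib) (simp add: power2_eq_square)
    ultimately show ?thesis by linarith
  qed
  have IH: "real (cf_denom (\<lambda>_. m) n) \<le> s ^ n" "s * real (cf_prev (\<lambda>_. m) n) \<le> s ^ n"
    using Suc by (auto simp: s_def)
  have "s * real (cf_denom (\<lambda>_. m) (Suc n)) =
      (real m * s) * real (cf_denom (\<lambda>_. m) n) + s * real (cf_prev (\<lambda>_. m) n)"
    by (simp add: cf_denom_Suc algebra_simps)
  also have "\<dots> \<le> (real m * s) * s ^ n + s ^ n"
    using IH s by (intro add_mono mult_left_mono) auto
  also have "\<dots> = (real m * s + 1) * s ^ n" by (simp add: algebra_simps)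
  also have "\<dots> \<le> s\<^sup>2 * s ^ n" using key s by (intro mult_right_mono) auto
  finally have "s * real (cf_denom (\<lambda>_. m) (Suc n)) \<le> s * s ^ Suc n" by (simp add: power2_eq_square)
  then have "real (cf_denom (\<lambda>_. m) (Suc n)) \<le> s ^ Suc n" using s by simp
  moreover have "s * real (cf_prev (\<lambda>_. m) (Suc n)) \<le> s ^ Suc n" using IH s by simp
  ultimately show ?case by (simp add: s_def)
qed simp

text \<open>The same denominator is estimated in two ways: the bound \<open>(m + 1) ^ n\<close> puts
  the cylinder into the slow set, the bound \<open>(sqrt 3 * m) ^ n\<close> makes it long. The
  factor 2 comes from \<open>q + q' \<le> 2 * q\<close>.\<close>

lemma measure_slow_set_ge:
  assumes m: "1 \<le> m" "real m + 1 \<le> exp (levy_const - \<epsilon>)" and n: "1 \<le> n"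
  shows "1 / (2 * (3 * (real m)\<^sup>2) ^ n) \<le> measure lebesgue (slow_set \<epsilon> n)"
proof -
  define a where "a = (\<lambda>_::nat. m)"
  define S where "S = open_segment (cf_moebius a n 0) (cf_moebius a n 1)"
  define q where "q = real (cf_denom a n)"
  define q' where "q' = real (cf_prev a n)"
  have pos: "1 \<le> a i" for i using m by (simp add: a_def)
  have q: "1 \<le> q" "0 \<le> q'" "q' \<le> q" using cf_denom_pos[of n a] pos by (auto simp: q_def q'_def)
  have sub: "S - \<rat> \<subseteq> slow_set \<epsilon> n"
  proof
    fix x assume "x \<in> S - \<rat>"
    then have x: "x \<in> {0<..<1} - \<rat>" "\<forall>i\<in>{1..n}. cf_digit x i = a i"
      using open_segment_in_cylinder[of n a x] pos by (auto simp: S_def)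
    have "cf_q n x = cf_denom a n"
      unfolding cf_q_def by (rule conjunct1[OF cf_denom_cong]) (use x in auto)
    also have "\<dots> \<le> (m + 1) ^ n" by (rule cf_denom_le_power) (use m in \<open>auto simp: a_def\<close>)
    finally have "real (cf_q n x) \<le> real ((m + 1) ^ n)" by (simp only: of_nat_le_iff)
    also have "\<dots> = (real m + 1) ^ n" by (simp add: add.commute)
    also have "\<dots> \<le> exp (levy_const - \<epsilon>) ^ n" using m by (intro power_mono) auto
    also have "\<dots> = exp (real n * (levy_const - \<epsilon>))" by (simp add: exp_of_nat_mult)
    finally show "x \<in> slow_set \<epsilon> n" using x slow_set_iff[OF n] by blast
  qed
  have "q\<^sup>2 \<le> ((sqrt 3 * real m) ^ n)\<^sup>2"
    using cf_denom_const_le[OF m(1), of n] q by (intro power_mono) (auto simp: q_def a_def)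
  also have "\<dots> = (3 * (real m)\<^sup>2) ^ n"
    by (simp add: power_mult_distrib power2_eq_square mult_ac flip: power_mult_distrib)
  finally have q2: "q\<^sup>2 \<le> (3 * (real m)\<^sup>2) ^ n" .
  have "q * (q + q') \<le> q * (2 * q)" using q by (intro mult_left_mono) auto
  also have "\<dots> = 2 * q\<^sup>2" by (simp add: power2_eq_square)
  also have "\<dots> \<le> 2 * (3 * (real m)\<^sup>2) ^ n" using q2 by simp
  finally have "1 / (2 * (3 * (real m)\<^sup>2) ^ n) \<le> 1 / (q * (q + q'))"
    using q m(1) by (intro divide_left_mono) (auto intro!: mult_pos_pos add_pos_nonneg zero_less_power)
  also have "\<dots> = measure lebesgue (closed_segment (cf_moebius a n 0) (cf_moebius a n 1))"
    unfolding measure_segment q_def q'_def by (rule cf_moebius_endpoints[symmetric]) (rule pos)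
  also have "\<dots> = measure lebesgue (S - \<rat>)"
  proof (rule measure_negligible_symdiff[symmetric])
    show "closed_segment (cf_moebius a n 0) (cf_moebius a n 1) \<in> lmeasurable"
      by (simp add: closed_segment_eq_real_ivl)
    have "countable (\<rat> \<union> {cf_moebius a n 0, cf_moebius a n 1})" using countable_rat by auto
    then have "negligible (\<rat> \<union> {cf_moebius a n 0, cf_moebius a n 1})"
      unfolding negligible_iff_null_sets by (intro null_sets_completionI countable_imp_null_set_lborel)
    then show "negligible (sym_diff (closed_segment (cf_moebius a n 0) (cf_moebius a n 1)) (S - \<rat>))"
      by (rule negligible_subset) (auto simp: S_def open_segment_def)
  qed
  also have "\<dots> \<le> measure lebesgue (slow_set \<epsilon> n)"
    by (rule measure_mono_fmeasurable[OF sub])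
      (use slow_set_lmeasurable rats_borel in \<open>auto simp: S_def open_segment_eq_real_ivl\<close>)
  finally show ?thesis .
qed

lemma liminf_log_rate_ge:
  assumes m: "1 \<le> m" "real m + 1 \<le> exp (levy_const - \<epsilon>)"
  shows "ereal (- 2 * ln (real m) - ln 3) \<le> liminf (log_rate \<epsilon>)"
proof -
  define r where "r = (\<lambda>n. - 2 * ln (real m) - ln 3 - ln 2 / real n)"
  have "ereal (r n) \<le> log_rate \<epsilon> n" if n: "1 \<le> n" for n
  proof -
    define X where "X = 1 / (2 * (3 * (real m)\<^sup>2) ^ n)"
    have X: "0 < X" using m by (simp add: X_def)
    have "ln X = - (ln 2 + real n * (ln 3 + 2 * ln (real m)))"
      using m by (simp add: X_def ln_div ln_mult_pos ln_realpow algebra_simps)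
    then have "r n = ln X / real n" using n by (simp add: r_def field_simps)
    then have "ereal (r n) = ereal (1 / real n) * elog X" using X by (simp add: elog_def)
    also have "\<dots> \<le> log_rate \<epsilon> n"
      unfolding log_rate_def
      using measure_slow_set_ge[OF m n] X by (intro ereal_mult_left_mono elog_mono) (auto simp: X_def)
    finally show ?thesis .
  qed
  then have "liminf (\<lambda>n. ereal (r n)) \<le> liminf (log_rate \<epsilon>)"
    by (intro Liminf_mono eventually_sequentiallyI[of 1]) auto
  moreover have "r \<longlonglongrightarrow> - 2 * ln (real m) - ln 3 - 0"
    unfolding r_def
    by (intro tendsto_intros tendsto_divide_0[OF tendsto_const] filterlim_at_top_imp_at_infinity
        filterlim_real_sequentially)
  then have "liminf (\<lambda>n. ereal (r n)) = ereal (- 2 * ln (real m) - ln 3)"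
    by (intro lim_imp_Liminf) auto
  ultimately show ?thesis by simp
qed

theorem theorem2p3:
  shows "(\<forall>\<epsilon>::real. 0 < \<epsilon> \<and> \<epsilon> \<le> levy_const \<longrightarrow>
            limsup (log_rate \<epsilon>) \<le> theta2 \<epsilon> \<and> theta2 \<epsilon> < 0)
       \<and> (\<forall>\<epsilon>::real. 0 < \<epsilon> \<and> \<epsilon> \<le> levy_const - ln 2 \<longrightarrow>
            liminf (log_rate \<epsilon>) \<ge> ereal (- 2 * ln (real_of_int (bstar \<epsilon>)) - ln 3))"
proof (intro conjI allI impI)
  fix \<epsilon> :: real assume "0 < \<epsilon> \<and> \<epsilon> \<le> levy_const"
  then show "theta2 \<epsilon> < 0" by (intro theta2_neg) auto
  show "limsup (log_rate \<epsilon>) \<le> theta2 \<epsilon>"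
    unfolding theta2_def by (rule INF_greatest) (auto intro: limsup_log_rate_le)
next
  fix \<epsilon> :: real assume \<epsilon>: "0 < \<epsilon> \<and> \<epsilon> \<le> levy_const - ln 2"
  \<comment> \<open>The assumption on \<open>\<epsilon>\<close> says that
    \<open>exp (levy_const - \<epsilon>)\<close> is at least 2, so \<open>bstar \<epsilon>\<close>
    is at least 1 and can serve as a digit.\<close>
  have "2 = exp (ln (2::real))" by simp
  also have "\<dots> \<le> exp (levy_const - \<epsilon>)" using \<epsilon> unfolding exp_le_cancel_iff by linarith
  finally have b: "1 \<le> bstar \<epsilon>" unfolding bstar_def by (simp only: one_le_floor)
  define m where "m = nat (bstar \<epsilon>)"
  have m: "real m = real_of_int (bstar \<epsilon>)" using b by (simp add: m_def)
  have "real_of_int (bstar \<epsilon>) \<le> exp (levy_const - \<epsilon>) - 1" unfolding bstar_def by (rule of_int_floor_le)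
  then have "real m + 1 \<le> exp (levy_const - \<epsilon>)" using m by simp
  moreover have "1 \<le> m" using b by (simp add: m_def)
  ultimately show "ereal (- 2 * ln (real_of_int (bstar \<epsilon>)) - ln 3) \<le> liminf (log_rate \<epsilon>)"
    using liminf_log_rate_ge[of m \<epsilon>] m by simp
qed

end
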